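(* Let $P$ be any nonempty $\Pi^0_1$ subset of $2^{\mathbb N}$. Then, for every special $\Pi^0_1$ set $Q\subseteq2^{\mathbb N}$, there exists a $\Pi^0_1$ set $\widehat P\subseteq\bigtriangledown P$ such that $Q\not\le^1_{<\omega}\widehat P$.
   Context: A set is special if it is nonempty and contains no computable element. With each $\Pi^0_1$ set $P\subseteq2^{\mathbb N}$ (given by an index) a corresponding computable tree $T_P\subseteq2^{<\mathbb N}$ whose set of infinite paths is $P$ is fixed; $L_P$ is the set of leaves (dead ends) of $T_P$. The concatenation is $P^\frown Q=P\cup\bigcup_{\rho\in L_P}\rho^\frown Q$ where $\rho^\frown Q=\{\rho^\frown f:f\in Q\}$, and $\bigtriangledown P=\bigcup_{n\in\mathbb N}(P^\frown\cdots{}^\frown P)$, where the $n$-th term is the iterated concatenation of $n+1$ copies of $P$; equivalently, $\bigtriangledown P=\{\rho_1{}^\frown\cdots{}^\frown\rho_k{}^\frown f:k\ge0,\ \rho_1,\dots,\rho_k\in L_P,\ f\in P\}$. Let $\{\Phi_e\}_{e\in\mathbb N}$ be an effective enumeration of all partial computable functions $\Phi_e:\subseteq\mathbb N^{\mathbb N}\to\mathbb N^{\mathbb N}$. A learner is a total computable function $\Psi:\mathbb N^{<\mathbb N}\to\mathbb N$. For $A,B\subseteq\mathbb N^{\mathbb N}$, $A\le^1_{<\omega}B$ means there is a partial function $\Gamma$ with $B\subseteq\mathrm{dom}(\Gamma)$, $\Gamma(g)\in A$ for all $g\in B$, and a learner $\Psi$ such that for every $g\in\mathrm{dom}(\Gamma)$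 the limit $\lim_n\Psi(g\upharpoonright n)$ exists and $\Phi_{\lim_n\Psi(g\upharpoonright n)}(g)=\Gamma(g)$, with $\sup_{g\in\mathrm{dom}(\Gamma)}\#\{n:\Psi(g\upharpoonright(n+1))\neq\Psi(g\upharpoonright n)\}<\omega$. *)

theory Defs
  imports Complex_Main "HOL-Library.Nat_Bijection" "HOL-Library.Omega_Words_Fun"
begin

text \<open>
  Kleene's partial recursive functions relative to an oracle \<open>g\<close>.  A vector of arguments is a list;
  \<open>None\<close> means divergence (and is also the value on lists that are too short for the program).
\<close>

datatype prog =
    Zero
  | Succ
  | Proj nat
  | Oracle
  | Comp prog "prog list"
  | Prec prog prog
  | Mu prog

primrec run :: "(nat \<Rightarrow> nat) \<Rightarrow> prog \<Rightarrow> nat list \<Rightarrow> nat option" where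
  "run g Zero = (\<lambda>xs. Some 0)"
| "run g Succ = (\<lambda>xs. case xs of [] \<Rightarrow> None | x # _ \<Rightarrow> Some (Suc x))"
| "run g (Proj i) = (\<lambda>xs. if i < length xs then Some (xs ! i) else None)"
| "run g Oracle = (\<lambda>xs. case xs of [] \<Rightarrow> None | x # _ \<Rightarrow> Some (g x))"
| "run g (Comp p qs) = (\<lambda>xs. Option.bind (those (map (\<lambda>q. run g q xs) qs)) (run g p))"
| "run g (Prec p q) = (\<lambda>xs. case xs of [] \<Rightarrow> None
     | x # ys \<Rightarrow> rec_nat (run g p ys) (\<lambda>n r. Option.bind r (\<lambda>y. run g q (n # y # ys))) x)"
| "run g (Mu p) = (\<lambda>xs.
     if \<exists>n. run g p (n # xs) = Some 0 \<and> (\<forall>m<n. run g p (m # xs) \<noteq> None)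
     then Some (LEAST n. run g p (n # xs) = Some 0) else None)"

text \<open>Unrelativized computability is computability relative to the computable oracle \<open>0\<close>.\<close>

definition computable :: "(nat \<Rightarrow> nat) \<Rightarrow> bool" where
  "computable f \<longleftrightarrow> (\<exists>p. \<forall>n. run (\<lambda>_. 0) p [n] = Some (f n))"

text \<open>Finite strings are coded by the bijection \<^const>\<open>list_encode\<close>.\<close>

definition computable_on_strings :: "(nat list \<Rightarrow> nat) \<Rightarrow> bool" where
  "computable_on_strings \<psi> \<longleftrightarrow> computable (\<lambda>c. \<psi> (list_decode c))"

definition computable_string_set :: "nat list set \<Rightarrow> bool" where
  "computable_string_set R \<longleftrightarrow> computable_on_strings (\<lambda>\<sigma>. if \<sigma> \<in> R then 1 else 0)"

text \<open>
  Partial functions on Baire space.  The domain of the functional given by a program consists of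
  those oracles for which the program converges on every input.
\<close>

type_synonym functional = "(nat \<Rightarrow> nat) \<Rightarrow> (nat \<Rightarrow> nat) option"

definition totalize :: "(nat \<Rightarrow> nat option) \<Rightarrow> (nat \<Rightarrow> nat) option" where
  "totalize h = (if \<forall>n. h n \<noteq> None then Some (\<lambda>n. the (h n)) else None)"

definition partial_computable :: "functional \<Rightarrow> bool" where
  "partial_computable F \<longleftrightarrow> (\<exists>p. \<forall>g. F g = totalize (\<lambda>n. run g p [n]))"

text \<open>
  The first conjunct says that every partial computable functional, and nothing else, is listed;
  the second is effectivity: one program computes \<open>\<Phi> e g n\<close> from \<open>e\<close> and \<open>n\<close> with oracle \<open>g\<close>.
\<close>

definition effective_enumeration :: "(nat \<Rightarrow> functional) \<Rightarrow> bool" where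
  "effective_enumeration \<Phi> \<longleftrightarrow>
     range \<Phi> = {F. partial_computable F} \<and>
     (\<exists>u. \<forall>e g. \<Phi> e g = totalize (\<lambda>n. run g u [e, n]))"

text \<open>Cantor space and its binary strings are regarded as parts of Baire space.\<close>

definition cantor :: "(nat \<Rightarrow> nat) set" where
  "cantor = {f. range f \<subseteq> {0, 1}}"

definition pi01 :: "(nat \<Rightarrow> nat) set \<Rightarrow> bool" where
  "pi01 P \<longleftrightarrow> (\<exists>R. computable_string_set R \<and> P = {f. \<forall>n. prefix n f \<in> R})"

definition special :: "(nat \<Rightarrow> nat) set \<Rightarrow> bool" where
  "special P \<longleftrightarrow> P \<noteq> {} \<and> (\<forall>f\<in>P. \<not> computable f)"

definition binary_tree :: "nat list set \<Rightarrow> bool" where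
  "binary_tree T \<longleftrightarrow> T \<subseteq> lists {0, 1} \<and> (\<forall>\<sigma> \<tau>. \<sigma> @ \<tau> \<in> T \<longrightarrow> \<sigma> \<in> T)"

definition paths :: "nat list set \<Rightarrow> (nat \<Rightarrow> nat) set" where
  "paths T = {f. \<forall>n. prefix n f \<in> T}"

definition leaves :: "nat list set \<Rightarrow> nat list set" where
  "leaves T = {\<rho> \<in> T. \<forall>\<tau>. \<rho> @ \<tau> \<in> T \<longrightarrow> \<tau> = []}"

text \<open>A computable tree representing the class \<open>P\<close>; the operations below depend on its leaves.\<close>

definition corresponding_tree :: "nat list set \<Rightarrow> (nat \<Rightarrow> nat) set \<Rightarrow> bool" where
  "corresponding_tree T P \<longleftrightarrow> binary_tree T \<and> computable_string_set T \<and> paths T = P"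

definition concatenation :: "nat list set \<Rightarrow> (nat \<Rightarrow> nat) set \<Rightarrow> (nat \<Rightarrow> nat) set" where
  "concatenation T Q = paths T \<union> (\<Union>\<rho>\<in>leaves T. (\<lambda>f. \<rho> \<frown> f) ` Q)"

text \<open>The \<open>n\<close>-th term of the union is the iterated concatenation of \<open>n + 1\<close> copies.\<close>

definition nabla :: "nat list set \<Rightarrow> (nat \<Rightarrow> nat) set" where
  "nabla T = (\<Union>n. (concatenation T ^^ n) (paths T))"

definition mind_changes :: "(nat list \<Rightarrow> nat) \<Rightarrow> (nat \<Rightarrow> nat) \<Rightarrow> nat set" where
  "mind_changes \<Psi> g = {n. \<Psi> (prefix (Suc n) g) \<noteq> \<Psi> (prefix n g)}"

definition learnable_bounded ::
    "(nat \<Rightarrow> functional) \<Rightarrow> functional \<Rightarrow> bool" where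
  "learnable_bounded \<Phi> \<Gamma> \<longleftrightarrow>
     (\<exists>\<Psi>. computable_on_strings \<Psi> \<and>
          (\<forall>g\<in>dom \<Gamma>. \<exists>e. (\<lambda>n. \<Psi> (prefix n g)) \<longlonglongrightarrow> e \<and> \<Phi> e g = \<Gamma> g) \<and>
          (\<exists>b. \<forall>g\<in>dom \<Gamma>. finite (mind_changes \<Psi> g) \<and> card (mind_changes \<Psi> g) \<le> b))"

text \<open>\<open>A \<le>\<^sup>1\<^bsub><\<omega>\<^esub> B\<close>, with respect to the enumeration \<open>\<Phi>\<close>\<close>

definition learn_reducible ::
    "(nat \<Rightarrow> functional) \<Rightarrow> (nat \<Rightarrow> nat) set \<Rightarrow> (nat \<Rightarrow> nat) set \<Rightarrow> bool" where
  "learn_reducible \<Phi> A B \<longleftrightarrow>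
     (\<exists>\<Gamma>. learnable_bounded \<Phi> \<Gamma> \<and> B \<subseteq> dom \<Gamma> \<and> (\<forall>g\<in>B. the (\<Gamma> g) \<in> A))"

end

theory Submission
  imports Defs
begin

text \<open>
  If \<open>P\<close> has a computable element \<open>f\<close>, then \<open>{f}\<close> is as required, because a reduction would produce a
  computable element of \<open>Q\<close>.  Otherwise every node of the tree of \<open>P\<close> extends to a leaf, and there
  are infinitely many leaves.  The \<open>n\<close>-th leaf \<open>\<rho>\<close> is devoted to the \<open>n\<close>-th pair of a learner and a
  bound \<open>b\<close> on its mind changes.  Starting from \<open>\<sigma> = \<rho>\<close>, keep appending leaves \<open>\<tau>\<close> such that \<open>\<sigma>\<tau>\<close>
  shows a conjecture \<open>e\<close> of the learner, made after \<open>\<sigma>\<close> and after at most \<open>b\<close> mind changes, for which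
  \<open>\<Phi> e\<close> outputs more than \<open>length \<sigma>\<close> values that lie on the tree of \<open>Q\<close>.  If this went on for ever, then
  the limit of the \<open>\<sigma>\<close> would be computable, the conjectures would converge, and \<open>\<Phi> e\<close> would map the
  limit to a computable element of \<open>Q\<close>.  So the process stops at some \<open>\<sigma>\<close>, and \<open>P'\<close> consists of \<open>P\<close>
  and the sets \<open>\<sigma>\<frown>P\<close>.  A reduction of \<open>Q\<close> to \<open>P'\<close> by this learner with bound \<open>b\<close> would
  succeed on a point of \<open>\<sigma>\<frown>P\<close>, and a finite part of that computation would allow one more step.
\<close>

section \<open>Computable functions of natural numbers\<close>

text \<open>Arguments are read off a list by position, so the arity \<open>k\<close> is given
  separately; only the values of \<open>f\<close> on lists of length \<open>k\<close> count.\<close>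

definition recfn :: "nat \<Rightarrow> (nat list \<Rightarrow> nat) \<Rightarrow> bool" where
  "recfn k f \<longleftrightarrow> (\<exists>p. \<forall>xs. length xs = k \<longrightarrow> run (\<lambda>_. 0) p xs = Some (f xs))"

lemma recfnI: "(\<And>xs. length xs = k \<Longrightarrow> run (\<lambda>_. 0) p xs = Some (f xs)) \<Longrightarrow> recfn k f"
  unfolding recfn_def by blast

lemma recfn_const: "recfn k (\<lambda>_. c)"
proof (induction c)
  case 0
  show ?case by (rule recfnI[of _ Zero]) simp
next
  case (Suc c)
  then obtain p where "\<And>xs. length xs = k \<Longrightarrow> run (\<lambda>_. 0) p xs = Some c"
    unfolding recfn_def by blast
  then show ?case by (intro recfnI[of _ "Comp Succ [p]"]) simp
qed

lemma recfn_nth: "i < k \<Longrightarrow> recfn k (\<lambda>xs. xs ! i)"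
  by (rule recfnI[of _ "Proj i"]) simp

lemma recfn_Suc:
  assumes "recfn k f"
  shows "recfn k (\<lambda>xs. Suc (f xs))"
proof -
  obtain p where "\<And>xs. length xs = k \<Longrightarrow> run (\<lambda>_. 0) p xs = Some (f xs)"
    using assms unfolding recfn_def by blast
  then show ?thesis by (intro recfnI[of _ "Comp Succ [p]"]) simp
qed

lemma recfn_comp1:
  assumes "recfn 1 g" "recfn k f"
  shows "recfn k (\<lambda>xs. g [f xs])"
proof -
  obtain p where "\<And>xs. length xs = k \<Longrightarrow> run (\<lambda>_. 0) p xs = Some (f xs)"
    using assms unfolding recfn_def by blast
  moreover obtain q where "\<And>xs. length xs = 1 \<Longrightarrow> run (\<lambda>_. 0) q xs = Some (g xs)"
    using assms unfolding recfn_def by blast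
  ultimately show ?thesis by (intro recfnI[of _ "Comp q [p]"]) simp
qed

text \<open>The projections rebuild the whole argument list. They pass the parameters of a recursion
  on unchanged.\<close>

lemma those_Proj:
  assumes "length xs = k"
  shows "those (map (\<lambda>q. run g q xs) (map Proj [0..<k])) = Some xs"
proof -
  have "those (map (\<lambda>q. run g q xs) (map Proj [j..<length xs])) = Some (drop j xs)"
    if "j \<le> length xs" for j
    using that
  proof (induction j rule: inc_induct)
    case base
    show ?case by simp
  next
    case (step j)
    then show ?case by (simp add: upt_conv_Cons Cons_nth_drop_Suc o_def)
  qed
  from this[of 0] show ?thesis using assms by simp
qed

text \<open>\<open>Prec\<close> expects the number of steps as its first argument. Composing it with
  a program for \<open>h\<close> and all projections makes this number a computable function of the
  parameters.\<close>

lemma recfn_rec_nat: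
  assumes "recfn k f" "recfn (Suc (Suc k)) g" "recfn k h"
  shows "recfn k (\<lambda>xs. rec_nat (f xs) (\<lambda>n r. g (n # r # xs)) (h xs))"
proof -
  obtain p where p: "\<And>xs. length xs = k \<Longrightarrow> run (\<lambda>_. 0) p xs = Some (f xs)"
    using assms unfolding recfn_def by blast
  obtain q where q: "\<And>xs. length xs = Suc (Suc k) \<Longrightarrow> run (\<lambda>_. 0) q xs = Some (g xs)"
    using assms unfolding recfn_def by blast
  obtain r where r: "\<And>xs. length xs = k \<Longrightarrow> run (\<lambda>_. 0) r xs = Some (h xs)"
    using assms unfolding recfn_def by blast
  have rec: "rec_nat (run (\<lambda>_. 0) p xs) (\<lambda>n r. Option.bind r (\<lambda>y. run (\<lambda>_. 0) q (n # y # xs))) m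
      = Some (rec_nat (f xs) (\<lambda>n r. g (n # r # xs)) m)" if "length xs = k" for xs m
    using that by (induction m) (simp_all add: p q)
  show ?thesis
    by (intro recfnI[of _ "Comp (Prec p q) (r # map Proj [0..<k])"])
      (simp add: r rec those_Proj del: map_map)
qed

text \<open>\<open>Mu\<close> demands that all smaller candidates converge, which holds because the
  program for \<open>g\<close> converges on every list of length \<open>Suc k\<close>.\<close>

lemma recfn_Least:
  assumes "recfn (Suc k) g" "\<And>xs. length xs = k \<Longrightarrow> \<exists>n. g (n # xs) = 0"
  shows "recfn k (\<lambda>xs. LEAST n. g (n # xs) = 0)"
proof -
  obtain p where p: "\<And>xs. length xs = Suc k \<Longrightarrow> run (\<lambda>_. 0) p xs = Some (g xs)"
    using assms unfolding recfn_def by blast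
  show ?thesis
    using assms(2) by (intro recfnI[of _ "Mu p"]) (simp add: p)
qed

lemma recfn_add:
  assumes "recfn k f" "recfn k g"
  shows "recfn k (\<lambda>xs. f xs + g xs)"
proof -
  have "recfn k (\<lambda>xs. rec_nat (g xs) (\<lambda>n r. Suc ((n # r # xs) ! 1)) (f xs))"
    by (intro recfn_rec_nat[where g = "\<lambda>ys. Suc (ys ! 1)"] assms recfn_Suc recfn_nth) simp
  moreover have "rec_nat a (\<lambda>n r. Suc r) b = b + a" for a b :: nat
    by (induction b) simp_all
  ultimately show ?thesis by simp
qed

lemma recfn_pred:
  assumes "recfn k f"
  shows "recfn k (\<lambda>xs. f xs - 1)"
proof -
  have "recfn k (\<lambda>xs. rec_nat 0 (\<lambda>n r. (n # r # xs) ! 0) (f xs))"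
    by (intro recfn_rec_nat[where g = "\<lambda>ys. ys ! 0"] assms recfn_const recfn_nth) simp
  moreover have "rec_nat 0 (\<lambda>n r. n) b = b - 1" for b :: nat
    by (cases b) simp_all
  ultimately show ?thesis by simp
qed

lemma recfn_diff:
  assumes "recfn k f" "recfn k g"
  shows "recfn k (\<lambda>xs. f xs - g xs)"
proof -
  have "recfn k (\<lambda>xs. rec_nat (f xs) (\<lambda>n r. (n # r # xs) ! 1 - 1) (g xs))"
    by (intro recfn_rec_nat[where g = "\<lambda>ys. ys ! 1 - 1"] assms recfn_pred recfn_nth) simp
  moreover have "rec_nat a (\<lambda>n r. r - 1) b = a - b" for a b :: nat
    by (induction b) simp_all
  ultimately show ?thesis by simp
qed

lemma recfn_triangle:
  assumes "recfn k f"
  shows "recfn k (\<lambda>xs. triangle (f xs))"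
proof -
  have "recfn k (\<lambda>xs. rec_nat 0 (\<lambda>n r. (n # r # xs) ! 1 + Suc ((n # r # xs) ! 0)) (f xs))"
    by (intro recfn_rec_nat[where g = "\<lambda>ys. ys ! 1 + Suc (ys ! 0)"]
        assms recfn_add recfn_const recfn_Suc recfn_nth) simp_all
  moreover have "rec_nat 0 (\<lambda>n r. r + Suc n) b = triangle b" for b
    by (induction b) simp_all
  ultimately show ?thesis by simp
qed

lemma recfn_prod_encode:
  assumes "recfn k f" "recfn k g"
  shows "recfn k (\<lambda>xs. prod_encode (f xs, g xs))"
  unfolding prod_encode_def prod.case by (intro recfn_add recfn_triangle assms)

lemma triangle_mono: "a \<le> b \<Longrightarrow> triangle a \<le> triangle b"
  by (induction rule: dec_induct) simp_all

lemma prod_encode_mono: "m \<le> m' \<Longrightarrow> n \<le> n' \<Longrightarrow> prod_encode (m, n) \<le> prod_encode (m', n')"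
  by (simp add: prod_encode_def add_mono triangle_mono)

text \<open>\<^term>\<open>prod_decode x\<close> lists the diagonal \<^term>\<open>m + n = k\<close> that satisfies
  \<^term>\<open>triangle k \<le> x \<and> x < triangle (Suc k)\<close>.\<close>

lemma prod_decode_Least:
  defines "k \<equiv> \<lambda>x. LEAST k. Suc x - triangle (Suc k) = 0"
  shows "fst (prod_decode x) = x - triangle (k x)" "snd (prod_decode x) = k x - (x - triangle (k x))"
proof -
  obtain m n where mn: "prod_decode x = (m, n)" by fastforce
  then have x: "x = triangle (m + n) + m"
    using prod_decode_inverse[of x] by (simp add: prod_encode_def)
  have "k x = m + n"
    unfolding k_def
  proof (rule Least_equality)
    show "Suc x - triangle (Suc (m + n)) = 0" using x by simp
  next
    fix l assume l: "Suc x - triangle (Suc l) = 0"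
    show "m + n \<le> l"
    proof (rule ccontr)
      assume "\<not> m + n \<le> l"
      then have "triangle (Suc l) \<le> triangle (m + n)" by (intro triangle_mono) simp
      then show False using l x by simp
    qed
  qed
  then show "fst (prod_decode x) = x - triangle (k x)"
    "snd (prod_decode x) = k x - (x - triangle (k x))"
    using mn x by simp_all
qed

lemma recfn_prod_decode:
  assumes "recfn k f"
  shows "recfn k (\<lambda>xs. fst (prod_decode (f xs)))" "recfn k (\<lambda>xs. snd (prod_decode (f xs)))"
proof -
  \<comment> \<open>The search is set up for the code alone, with the candidate at position 0 and
    the code at position 1; \<open>f\<close> is substituted afterwards.\<close>
  have "recfn 1 (\<lambda>xs. LEAST n. Suc ((n # xs) ! 1) - triangle (Suc ((n # xs) ! 0)) = 0)"
  proof (rule recfn_Least[where g = "\<lambda>ys. Suc (ys ! 1) - triangle (Suc (ys ! 0))"])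
    show "recfn (Suc 1) (\<lambda>ys. Suc (ys ! 1) - triangle (Suc (ys ! 0)))"
      by (intro recfn_diff recfn_Suc recfn_triangle recfn_nth) simp_all
    fix xs :: "nat list"
    \<comment> \<open>By this inequality the candidate \<open>n = xs ! 0\<close> satisfies the
      condition.\<close>
    have "m \<le> triangle m" for m by (induction m) simp_all
    then show "\<exists>n. Suc ((n # xs) ! 1) - triangle (Suc ((n # xs) ! 0)) = 0"
      by (metis diff_is_0_eq nth_Cons_0 nth_Cons_Suc One_nat_def Suc_le_mono le_SucI)
  qed
  from recfn_comp1[OF this assms]
  have k: "recfn k (\<lambda>xs. LEAST n. Suc (f xs) - triangle (Suc n) = 0)" by simp
  show "recfn k (\<lambda>xs. fst (prod_decode (f xs)))" "recfn k (\<lambda>xs. snd (prod_decode (f xs)))"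
    unfolding prod_decode_Least by (intro recfn_diff recfn_triangle k assms)+
qed

section \<open>Unary computability with coded pairs\<close>

lemma computable_recfn: "computable f \<longleftrightarrow> recfn 1 (\<lambda>xs. f (xs ! 0))"
proof -
  have "(\<forall>xs. length xs = 1 \<longrightarrow> run (\<lambda>_. 0) p xs = Some (f (xs ! 0))) \<longleftrightarrow>
      (\<forall>n. run (\<lambda>_. 0) p [n] = Some (f n))" for p
    by (auto simp: length_Suc_conv)
  then show ?thesis unfolding computable_def recfn_def by simp
qed

lemma computable_id: "computable (\<lambda>x. x)"
  unfolding computable_recfn by (rule recfn_nth) simp

lemma computable_const: "computable (\<lambda>_. c)"
  unfolding computable_recfn by (rule recfn_const)

lemma computable_comp: "computable f \<Longrightarrow> computable g \<Longrightarrow> computable (\<lambda>x. f (g x))"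
  unfolding computable_recfn using recfn_comp1[of "\<lambda>xs. f (xs ! 0)" 1 "\<lambda>xs. g (xs ! 0)"] by simp

lemma computable_Suc: "computable Suc"
  unfolding computable_recfn by (intro recfn_Suc recfn_nth) simp

lemma computable_diff:
  "computable f \<Longrightarrow> computable g \<Longrightarrow> computable (\<lambda>x. f x - g x)"
  unfolding computable_recfn by (rule recfn_diff)

lemma computable_prod_encode:
  "computable f \<Longrightarrow> computable g \<Longrightarrow> computable (\<lambda>x. prod_encode (f x, g x))"
  unfolding computable_recfn by (rule recfn_prod_encode)

lemma computable_prod_decode:
  "computable (\<lambda>x. fst (prod_decode x))" "computable (\<lambda>x. snd (prod_decode x))"
  unfolding computable_recfn by (intro recfn_prod_decode recfn_nth; simp)+

lemma computable_rec_nat: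
  assumes "computable f" "computable g" "computable h"
  shows "computable (\<lambda>x. rec_nat (f x) (\<lambda>n r. g (prod_encode (x, prod_encode (n, r)))) (h x))"
proof -
  have "recfn (Suc (Suc 1)) (\<lambda>ys. g (prod_encode (ys ! 2, prod_encode (ys ! 0, ys ! 1))))"
    using recfn_comp1[OF assms(2)[unfolded computable_recfn]
        recfn_prod_encode[OF recfn_nth recfn_prod_encode[OF recfn_nth recfn_nth]], of 2 3 0 1]
    by (simp add: numeral_3_eq_3)
  from recfn_rec_nat[OF assms(1)[unfolded computable_recfn] this assms(3)[unfolded computable_recfn]]
  show ?thesis unfolding computable_recfn by (simp add: numeral_2_eq_2)
qed

lemma computable_Least:
  assumes "computable g" "\<And>x. \<exists>n. g (prod_encode (x, n)) = 0"
  shows "computable (\<lambda>x. LEAST n. g (prod_encode (x, n)) = 0)"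
proof -
  have "recfn (Suc 1) (\<lambda>ys. g (prod_encode (ys ! 1, ys ! 0)))"
    using recfn_comp1[OF assms(1)[unfolded computable_recfn]
        recfn_prod_encode[OF recfn_nth recfn_nth], of 1 2 0]
    by (simp add: numeral_2_eq_2)
  from recfn_Least[OF this] show ?thesis
    unfolding computable_recfn using assms(2) by simp
qed

section \<open>Computable functions on coded types\<close>

text \<open>A numerical function that represents a map has to be right on codes only. So codings
  need not be onto, and that of \<open>bool\<close> is not.\<close>

class coded =
  fixes enc :: "'a \<Rightarrow> nat"
  assumes inj_enc: "inj enc"

lemma enc_eq_iff: "enc x = enc y \<longleftrightarrow> x = y"
  using inj_enc by (rule inj_eq)

instantiation nat :: coded
begin
definition enc_nat :: "nat \<Rightarrow> nat" where [simp]: "enc_nat n = n"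
instance by standard (simp add: inj_def)
end

instantiation bool :: coded
begin
definition enc_bool :: "bool \<Rightarrow> nat" where "enc_bool b = of_bool b"
instance by standard (simp add: inj_def enc_bool_def)
end

instantiation prod :: (coded, coded) coded
begin
definition enc_prod :: "'a \<times> 'b \<Rightarrow> nat" where "enc_prod p = prod_encode (enc (fst p), enc (snd p))"
instance by standard (auto simp: inj_def enc_prod_def enc_eq_iff)
end

instantiation option :: (coded) coded
begin
definition enc_option :: "'a option \<Rightarrow> nat" where
  "enc_option x = (case x of None \<Rightarrow> 0 | Some y \<Rightarrow> Suc (enc y))"
instance by standard (auto simp: inj_def enc_option_def enc_eq_iff split: option.splits)
end

instantiation list :: (coded) coded
begin
definition enc_list :: "'a list \<Rightarrow> nat" where "enc_list xs = list_encode (map enc xs)"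
instance by standard (simp add: inj_def enc_list_def list_encode_eq inj_map_eq_map[OF inj_enc])
end

lemma enc_nat_list: "enc (xs :: nat list) = list_encode xs"
  by (simp add: enc_list_def map_idI)

text \<open>Decidable predicates are included as the effective functions to
  \<open>bool\<close>.\<close>

definition effective :: "('a::coded \<Rightarrow> 'b::coded) \<Rightarrow> bool" where
  "effective f \<longleftrightarrow> (\<exists>h. computable h \<and> (\<forall>x. h (enc x) = enc (f x)))"

lemma effectiveI: "computable h \<Longrightarrow> (\<And>x. h (enc x) = enc (f x)) \<Longrightarrow> effective f"
  unfolding effective_def by blast

lemma effective_computable: "effective f \<longleftrightarrow> computable f" for f :: "nat \<Rightarrow> nat"
proof
  show "computable f" if f: "effective f"
  proof -
    obtain h where "computable h" "\<And>x. h (enc x) = enc (f x)"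
      using f unfolding effective_def by blast
    moreover from this(2) have "h = f" by auto
    ultimately show ?thesis by simp
  qed
qed (rule effectiveI, auto)

text \<open>\<open>list_encode\<close> is onto, so the values on codes determine the representing
  function everywhere. This links \<open>effective\<close> with the notions defined for
  strings.\<close>

lemma effective_on_strings: "computable_on_strings f \<longleftrightarrow> effective f"
proof
  show "effective f" if "computable_on_strings f"
    using that unfolding computable_on_strings_def
    by (rule effectiveI) (simp add: enc_nat_list)
  show "computable_on_strings f" if f: "effective f"
  proof -
    obtain h where h: "computable h" "\<And>x. h (enc x) = enc (f x)"
      using f unfolding effective_def by blast
    have "h c = f (list_decode c)" for c
      using h(2)[of "list_decode c"] by (simp add: enc_nat_list)
    then show ?thesis using h(1) unfolding computable_on_strings_def by presburger
  qed
qed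

lemma effective_const: "effective (\<lambda>_. c)"
  by (rule effectiveI[OF computable_const]) simp

lemma effective_id: "effective (\<lambda>x. x)"
  by (rule effectiveI[OF computable_id]) simp

lemma effective_comp:
  assumes "effective g" "effective f"
  shows "effective (\<lambda>x. g (f x))"
proof -
  obtain h where h: "computable h" "\<And>x. h (enc x) = enc (f x)"
    using assms(2) unfolding effective_def by blast
  obtain k where k: "computable k" "\<And>x. k (enc x) = enc (g x)"
    using assms(1) unfolding effective_def by blast
  show ?thesis by (rule effectiveI[OF computable_comp[OF k(1) h(1)]]) (simp add: h k)
qed

lemma effective_enc: "effective f \<Longrightarrow> effective (\<lambda>x. enc (f x))"
  by (rule effective_comp[where g = enc], rule effectiveI[OF computable_id]) auto

text \<open>\<open>effective\<close> speaks of codes only. A value may therefore be replaced by its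
  code and handled by arithmetic, as is done below for constructors and comparisons.\<close>

lemma effective_encD:
  assumes "effective (\<lambda>x. enc (f x))"
  shows "effective f"
  using assms unfolding effective_def by simp

lemma effective_Suc: "effective f \<Longrightarrow> effective (\<lambda>x. Suc (f x))"
  by (rule effective_comp[where g = Suc]) (simp add: effective_computable computable_Suc)

lemma effective_Pair:
  assumes "effective f" "effective g"
  shows "effective (\<lambda>x. (f x, g x))"
proof -
  obtain h where h: "computable h" "\<And>x. h (enc x) = enc (f x)"
    using assms(1) unfolding effective_def by blast
  obtain k where k: "computable k" "\<And>x. k (enc x) = enc (g x)"
    using assms(2) unfolding effective_def by blast
  show ?thesis
    by (rule effectiveI[OF computable_prod_encode[OF h(1) k(1)]]) (simp add: h k enc_prod_def)
qed

lemma effective_comp2: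
  assumes "effective (\<lambda>p. g (fst p) (snd p))" "effective f" "effective h"
  shows "effective (\<lambda>x. g (f x) (h x))"
  using effective_comp[OF assms(1) effective_Pair[OF assms(2,3)]] by simp

lemma effective_fst: "effective f \<Longrightarrow> effective (\<lambda>x. fst (f x))"
  by (rule effective_comp[where g = fst], rule effectiveI[OF computable_prod_decode(1)])
    (simp_all add: enc_prod_def)

lemma effective_snd: "effective f \<Longrightarrow> effective (\<lambda>x. snd (f x))"
  by (rule effective_comp[where g = snd], rule effectiveI[OF computable_prod_decode(2)])
    (simp_all add: enc_prod_def)

text \<open>In the rules for binders, the bound variables are read off an environment that is a tuple;
  this keeps the premises in the form in which the rules apply again.\<close>

lemma effective_rec_nat:
  assumes "effective f" "effective (\<lambda>p. g (fst p) (fst (snd p)) (snd (snd p)))" "effective h"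
  shows "effective (\<lambda>x. rec_nat (f x) (\<lambda>n r. g x n r) (h x))"
proof -
  obtain f' where f: "computable f'" "\<And>x. f' (enc x) = enc (f x)"
    using assms(1) unfolding effective_def by blast
  obtain g' where g: "computable g'"
      "\<And>p. g' (enc p) = enc (g (fst p) (fst (snd p)) (snd (snd p)))"
    using assms(2) unfolding effective_def by blast
  obtain h' where h: "computable h'" "\<And>x. h' (enc x) = enc (h x)"
    using assms(3) unfolding effective_def by blast
  have g': "g' (prod_encode (enc x, prod_encode (n, enc r))) = enc (g x n r)" for x n r
    using g(2)[of "(x, n, r)"] by (simp add: enc_prod_def)
  have "rec_nat (enc (f x)) (\<lambda>n r. g' (prod_encode (enc x, prod_encode (n, r)))) m =
      enc (rec_nat (f x) (\<lambda>n r. g x n r) m)" for x m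
    by (induction m) (simp_all add: g')
  then show ?thesis
    by (intro effectiveI[OF computable_rec_nat[OF f(1) g(1) h(1)]]) (simp add: f h)
qed

text \<open>Primitive recursion with a step that ignores the recursive value. Since
  \<open>None\<close> and \<open>[]\<close> have code 0 and all other options and lists have
  successor codes, it yields the case distinctions on both types.\<close>

lemma computable_case_nat:
  assumes "computable f" "computable a" "computable b"
  shows "computable (\<lambda>x. case f x of 0 \<Rightarrow> a x | Suc m \<Rightarrow> b (prod_encode (x, m)))"
proof -
  have "computable (\<lambda>z. b (prod_encode (fst (prod_decode z), fst (prod_decode (snd (prod_decode z))))))"
    by (intro computable_comp[OF assms(3)] computable_prod_encode
        computable_comp[OF computable_prod_decode(1) computable_prod_decode(2)] computable_prod_decode)
  from computable_rec_nat[OF assms(2) this assms(1)]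
  have "computable (\<lambda>x. rec_nat (a x) (\<lambda>n r. b (prod_encode (x, n))) (f x))" by simp
  moreover have "rec_nat (a x) (\<lambda>n r. b (prod_encode (x, n))) m =
      (case m of 0 \<Rightarrow> a x | Suc m \<Rightarrow> b (prod_encode (x, m)))" for x m
    by (cases m) simp_all
  ultimately show ?thesis by simp
qed

lemma effective_case_option:
  assumes "effective f" "effective a" "effective (\<lambda>p. b (fst p) (snd p))"
  shows "effective (\<lambda>x. case f x of None \<Rightarrow> a x | Some y \<Rightarrow> b x y)"
proof -
  obtain f' where f: "computable f'" "\<And>x. f' (enc x) = enc (f x)"
    using assms(1) unfolding effective_def by blast
  obtain a' where a: "computable a'" "\<And>x. a' (enc x) = enc (a x)"
    using assms(2) unfolding effective_def by blast
  obtain b' where b: "computable b'" "\<And>p. b' (enc p) = enc (b (fst p) (snd p))"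
    using assms(3) unfolding effective_def by blast
  have "b' (prod_encode (enc x, enc y)) = enc (b x y)" for x y
    using b(2)[of "(x, y)"] by (simp add: enc_prod_def)
  then show ?thesis
    by (intro effectiveI[OF computable_case_nat[OF f(1) a(1) b(1)]])
      (simp add: f a enc_option_def split: option.split)
qed

lemma effective_case_list:
  assumes "effective f" "effective a" "effective (\<lambda>p. b (fst p) (fst (snd p)) (snd (snd p)))"
  shows "effective (\<lambda>x. case f x of [] \<Rightarrow> a x | y # ys \<Rightarrow> b x y ys)"
proof -
  obtain f' where f: "computable f'" "\<And>x. f' (enc x) = enc (f x)"
    using assms(1) unfolding effective_def by blast
  obtain a' where a: "computable a'" "\<And>x. a' (enc x) = enc (a x)"
    using assms(2) unfolding effective_def by blast
  obtain b' where b: "computable b'"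
      "\<And>p. b' (enc p) = enc (b (fst p) (fst (snd p)) (snd (snd p)))"
    using assms(3) unfolding effective_def by blast
  have "b' (prod_encode (enc x, prod_encode (enc y, list_encode (map enc ys)))) = enc (b x y ys)"
    for x y ys
    using b(2)[of "(x, y, ys)"] by (simp add: enc_prod_def enc_list_def)
  then show ?thesis
    by (intro effectiveI[OF computable_case_nat[OF f(1) a(1) b(1)]])
      (simp add: f a enc_list_def split: list.split)
qed

lemma effective_Cons:
  assumes "effective f" "effective g"
  shows "effective (\<lambda>x. f x # g x)"
proof -
  have *: "enc (f x # g x) = Suc (enc (f x, g x))" for x
    by (simp add: enc_list_def enc_prod_def)
  show ?thesis
    by (rule effective_encD) (unfold *, intro effective_Suc effective_enc effective_Pair assms)
qed

lemma effective_Some: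
  assumes "effective f"
  shows "effective (\<lambda>x. Some (f x))"
proof -
  have *: "enc (Some (f x)) = Suc (enc (f x))" for x
    by (simp add: enc_option_def)
  show ?thesis
    by (rule effective_encD) (unfold *, intro effective_Suc effective_enc assms)
qed

section \<open>Decidable predicates and bounded quantifiers\<close>

lemma effective_If:
  assumes "effective c" "effective a" "effective b"
  shows "effective (\<lambda>x. if c x then a x else b x)"
proof -
  \<comment> \<open>The recursion has length 0 or 1, according to the truth value.\<close>
  have "effective (\<lambda>x. rec_nat (b x) (\<lambda>_ _. a x) (enc (c x)))"
    by (intro effective_rec_nat effective_enc effective_comp[OF assms(2)] effective_fst effective_id
        assms)
  moreover have "rec_nat (b x) (\<lambda>_ _. a x) (enc (c x)) = (if c x then a x else b x)" for x
    by (simp add: enc_bool_def)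
  ultimately show ?thesis by simp
qed

lemma effective_not:
  assumes "effective P"
  shows "effective (\<lambda>x. \<not> P x)"
proof -
  have "(if P x then False else True) \<longleftrightarrow> \<not> P x" for x by simp
  then show ?thesis
    using effective_If[OF assms effective_const[of False] effective_const[of True]] by simp
qed

lemma effective_conj:
  assumes "effective P" "effective Q"
  shows "effective (\<lambda>x. P x \<and> Q x)"
proof -
  have "(if P x then Q x else False) \<longleftrightarrow> P x \<and> Q x" for x by simp
  then show ?thesis using effective_If[OF assms effective_const[of False]] by simp
qed

lemma effective_disj:
  assumes "effective P" "effective Q"
  shows "effective (\<lambda>x. P x \<or> Q x)"
  using effective_not[OF effective_conj[OF effective_not[OF assms(1)] effective_not[OF assms(2)]]]
  by simp

lemma effective_diff:
  assumes "effective f" "effective g"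
  shows "effective (\<lambda>x. f x - g x :: nat)"
proof -
  obtain h where h: "computable h" "\<And>x. h (enc x) = enc (f x)"
    using assms(1) unfolding effective_def by blast
  obtain k where k: "computable k" "\<And>x. k (enc x) = enc (g x)"
    using assms(2) unfolding effective_def by blast
  show ?thesis by (rule effectiveI[OF computable_diff[OF h(1) k(1)]]) (simp add: h k)
qed

lemma effective_le:
  assumes "effective f" "effective g"
  shows "effective (\<lambda>x. f x \<le> (g x :: nat))"
proof -
  have *: "enc (f x \<le> g x) = 1 - (f x - g x)" for x
    by (simp add: enc_bool_def)
  show ?thesis
    by (rule effective_encD) (unfold *, intro effective_diff effective_const assms)
qed

lemma effective_less:
  assumes "effective f" "effective g"
  shows "effective (\<lambda>x. f x < (g x :: nat))"
  using effective_not[OF effective_le[OF assms(2,1)]] by (simp add: not_le)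

lemma effective_eq:
  assumes "effective f" "effective g"
  shows "effective (\<lambda>x. f x = g x)"
proof -
  \<comment> \<open>By injectivity, equality on any coded type is equality of codes.\<close>
  have "effective (\<lambda>x. enc (f x) \<le> enc (g x) \<and> enc (g x) \<le> enc (f x))"
    by (intro effective_conj effective_le effective_enc assms)
  moreover have "enc (f x) \<le> enc (g x) \<and> enc (g x) \<le> enc (f x) \<longleftrightarrow> f x = g x" for x
    using enc_eq_iff[of "f x" "g x"] by auto
  ultimately show ?thesis by simp
qed

lemma effective_All_less:
  fixes P :: "'a::coded \<Rightarrow> nat \<Rightarrow> bool"
  assumes "effective (\<lambda>p. P (fst p) (snd p))" "effective h"
  shows "effective (\<lambda>x. \<forall>i<h x. P x i)"
proof -
  have "effective (\<lambda>x. rec_nat True (\<lambda>i r. P x i \<and> r) (h x))"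
    by (intro effective_rec_nat effective_const effective_conj assms effective_snd effective_id
        effective_comp2[OF assms(1)]
        effective_Pair effective_fst)
  moreover have "rec_nat True (\<lambda>i r. P x i \<and> r) m \<longleftrightarrow> (\<forall>i<m. P x i)" for x m
    by (induction m) (auto simp: less_Suc_eq)
  ultimately show ?thesis by simp
qed

lemma effective_Ex_less:
  fixes P :: "'a::coded \<Rightarrow> nat \<Rightarrow> bool"
  assumes "effective (\<lambda>p. P (fst p) (snd p))" "effective h"
  shows "effective (\<lambda>x. \<exists>i<h x. P x i)"
  using effective_not[OF effective_All_less[OF effective_not[OF assms(1)] assms(2)]] by simp

lemma effective_All_le:
  fixes P :: "'a::coded \<Rightarrow> nat \<Rightarrow> bool"
  assumes "effective (\<lambda>p. P (fst p) (snd p))" "effective h"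
  shows "effective (\<lambda>x. \<forall>i\<le>h x. P x i)"
  using effective_All_less[OF assms(1) effective_Suc[OF assms(2)]] by (simp add: less_Suc_eq_le)

lemma effective_Ex_le:
  fixes P :: "'a::coded \<Rightarrow> nat \<Rightarrow> bool"
  assumes "effective (\<lambda>p. P (fst p) (snd p))" "effective h"
  shows "effective (\<lambda>x. \<exists>i\<le>h x. P x i)"
  using effective_Ex_less[OF assms(1) effective_Suc[OF assms(2)]] by (simp add: less_Suc_eq_le)

text \<open>Used in two ways: for the number of mind changes before a stage, and for the rank of a
  code in an infinite set.\<close>

definition count :: "(nat \<Rightarrow> bool) \<Rightarrow> nat \<Rightarrow> nat" where
  "count P n = card {i. i < n \<and> P i}"

lemma count_Suc: "count P (Suc n) = (if P n then Suc (count P n) else count P n)"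
proof -
  have "{i. i < Suc n \<and> P i} = (if P n then insert n {i. i < n \<and> P i} else {i. i < n \<and> P i})"
    by (auto simp: less_Suc_eq)
  then show ?thesis by (simp add: count_def)
qed

lemma effective_count:
  fixes P :: "'a::coded \<Rightarrow> nat \<Rightarrow> bool"
  assumes "effective (\<lambda>p. P (fst p) (snd p))" "effective h"
  shows "effective (\<lambda>x. count (\<lambda>i. P x i) (h x))"
proof -
  have "effective (\<lambda>x. rec_nat 0 (\<lambda>i r. if P x i then Suc r else r) (h x))"
    by (intro effective_rec_nat effective_const effective_If effective_Suc assms effective_snd
        effective_id effective_comp2[OF assms(1)]
        effective_Pair effective_fst)
  moreover have "rec_nat 0 (\<lambda>i r. if P x i then Suc r else r) m = count (\<lambda>i. P x i) m" for x m
    by (induction m) (simp_all add: count_Suc, simp add: count_def)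
  ultimately show ?thesis by simp
qed

lemma effective_Least:
  fixes P :: "nat \<Rightarrow> nat \<Rightarrow> bool"
  assumes "effective (\<lambda>p. P (fst p) (snd p))" "\<And>x. \<exists>n. P x n"
  shows "effective (\<lambda>x. LEAST n. P x n)"
proof -
  obtain h where h: "computable h" "\<And>p. h (enc p) = enc (P (fst p) (snd p))"
    using assms(1) unfolding effective_def by blast
  have "h (prod_encode (x, n)) = of_bool (P x n)" for x n
    using h(2)[of "(x, n)"] by (simp add: enc_prod_def enc_bool_def)
  then have *: "1 - h (prod_encode (x, n)) = 0 \<longleftrightarrow> P x n" for x n
    by simp
  have "computable (\<lambda>x. LEAST n. 1 - h (prod_encode (x, n)) = 0)"
    by (intro computable_Least[where g = "\<lambda>x. 1 - h x"] computable_diff computable_const h(1))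
      (simp only: * assms(2))
  then show ?thesis unfolding * by (simp add: effective_computable)
qed

lemmas effective_basic =
  effective_id effective_const effective_Suc effective_Pair effective_fst effective_snd
  effective_rec_nat effective_case_option effective_case_list effective_Cons effective_Some
  effective_If effective_not effective_conj effective_disj effective_diff effective_le
  effective_less effective_eq effective_All_less effective_Ex_less effective_All_le
  effective_Ex_le effective_count

lemma effective_bind:
  assumes "effective f" "effective (\<lambda>p. g (fst p) (snd p))"
  shows "effective (\<lambda>x. Option.bind (f x) (\<lambda>y. g x y))"
proof -
  have *: "Option.bind (f x) (g x) = (case f x of None \<Rightarrow> None | Some y \<Rightarrow> g x y)" for x
    by (cases "f x") simp_all
  show ?thesis unfolding * by (intro effective_basic assms)
qed

lemma effective_the: "effective f \<Longrightarrow> effective (\<lambda>x. the (f x))"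
proof -
  assume f: "effective f"
  \<comment> \<open>\<open>the None\<close> is unspecified but fixed, hence a constant;
    \<open>hd []\<close> is treated alike below.\<close>
  have "effective (\<lambda>x. case f x of None \<Rightarrow> the None | Some y \<Rightarrow> y)"
    by (intro effective_basic f)
  moreover have "(case a of None \<Rightarrow> the None | Some y \<Rightarrow> y) = the a" for a :: "'b option"
    by (cases a) simp_all
  ultimately show ?thesis by simp
qed

lemma effective_hd: "effective f \<Longrightarrow> effective (\<lambda>x. hd (f x))"
proof -
  assume f: "effective f"
  have "effective (\<lambda>x. case f x of [] \<Rightarrow> hd [] | y # _ \<Rightarrow> y)"
    by (intro effective_basic f)
  moreover have "(case a of [] \<Rightarrow> hd [] | y # _ \<Rightarrow> y) = hd a" for a :: "'b list"
    by (cases a) simp_all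
  ultimately show ?thesis by simp
qed

lemma effective_tl: "effective f \<Longrightarrow> effective (\<lambda>x. tl (f x))"
proof -
  assume f: "effective f"
  have "effective (\<lambda>x. case f x of [] \<Rightarrow> [] | _ # ys \<Rightarrow> ys)"
    by (intro effective_basic f)
  then show ?thesis by (simp add: tl_def)
qed

section \<open>Operations on lists\<close>

lemma effective_drop:
  assumes "effective f" "effective g"
  shows "effective (\<lambda>x. drop (f x) (g x))"
proof -
  have "effective (\<lambda>x. rec_nat (g x) (\<lambda>_ r. tl r) (f x))"
    by (intro effective_basic effective_tl assms)
  moreover have "rec_nat xs (\<lambda>_ r. tl r) n = drop n xs" for xs :: "'b list" and n
    by (induction n) (simp_all add: drop_Suc tl_drop)
  ultimately show ?thesis by simp
qed

text \<open>Each entry raises the code by at least one. Hence a code provides enough steps to run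
  through its list, and long leaves have large codes.\<close>

lemma length_le_list_encode: "length xs \<le> list_encode xs"
  by (induction xs) (auto intro: order_trans[OF _ le_prod_encode_2])

lemma effective_foldl:
  assumes "effective (\<lambda>p. g (fst p) (fst (snd p)) (snd (snd p)))" "effective a" "effective l"
  shows "effective (\<lambda>x. foldl (\<lambda>r y. g x r y) (a x) (l x))"
proof -
  \<comment> \<open>The state consists of the accumulator and the unread part of the list. The
    recursion runs for \<open>enc (l x)\<close> steps, and steps after the end of the list change
    nothing.\<close>
  let ?step = "\<lambda>x q. case snd q of [] \<Rightarrow> q | y # ys \<Rightarrow> (g x (fst q) y, ys)"
  have g: "effective (\<lambda>q. g (f q) (r q) (h q))"
    if "effective f" "effective r" "effective h" for f :: "'d::coded \<Rightarrow> _" and r h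
    using effective_comp[OF assms(1) effective_Pair[OF that(1) effective_Pair[OF that(2,3)]]]
    by simp
  have "effective (\<lambda>x. fst (rec_nat (a x, l x) (\<lambda>_ q. ?step x q) (enc (l x))))"
    by (intro effective_basic effective_enc g assms)
  moreover have "rec_nat (r, ys) (\<lambda>_ q. ?step x q) n = (foldl (g x) r (take n ys), drop n ys)"
    for x r ys n
  proof (induction n)
    case (Suc n)
    show ?case
    proof (cases "n < length ys")
      case True
      then show ?thesis
        using Suc by (simp add: take_Suc_conv_app_nth Cons_nth_drop_Suc[symmetric])
    qed (use Suc in simp)
  qed simp
  moreover have "length ys \<le> enc ys" for ys :: "'c list"
    using length_le_list_encode[of "map enc ys"] by (simp add: enc_list_def)
  ultimately show ?thesis by simp
qed

lemma effective_length:
  assumes "effective f"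
  shows "effective (\<lambda>x. length (f x))"
proof -
  have "effective (\<lambda>x. foldl (\<lambda>n _. Suc n) 0 (f x))"
    by (intro effective_foldl effective_basic assms)
  moreover have "foldl (\<lambda>n _. Suc n) m ys = m + length ys" for m and ys :: "'b list"
    by (induction ys arbitrary: m) simp_all
  ultimately show ?thesis by simp
qed

lemma effective_append:
  assumes "effective f" "effective g"
  shows "effective (\<lambda>x. f x @ g x)"
proof -
  \<comment> \<open>The inner fold reverses \<open>f x\<close>; the outer one pushes the entries in
    front of \<open>g x\<close>.\<close>
  have "effective (\<lambda>x. foldl (\<lambda>r y. y # r) (g x) (foldl (\<lambda>r y. y # r) [] (f x)))"
    by (intro effective_foldl effective_basic assms)
  moreover have "foldl (\<lambda>r y. y # r) zs ys = rev ys @ zs" for ys zs :: "'b list"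
    by (induction ys arbitrary: zs) simp_all
  ultimately show ?thesis by simp
qed

lemma effective_map:
  assumes "effective (\<lambda>p. g (fst p) (snd p))" "effective f"
  shows "effective (\<lambda>x. map (\<lambda>y. g x y) (f x))"
proof -
  have "effective (\<lambda>x. foldl (\<lambda>r y. r @ [g x y]) [] (f x))"
    by (intro effective_foldl effective_append effective_basic effective_comp2[OF assms(1)] assms(2))
  moreover have "foldl (\<lambda>r y. r @ [g x y]) zs ys = zs @ map (g x) ys" for x ys zs
    by (induction ys arbitrary: zs) simp_all
  ultimately show ?thesis by simp
qed

lemma effective_upt:
  assumes "effective f"
  shows "effective (\<lambda>x. [0..<f x])"
proof -
  have "effective (\<lambda>x. rec_nat [] (\<lambda>n r. r @ [n]) (f x))"
    by (intro effective_append effective_basic assms)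
  moreover have "rec_nat [] (\<lambda>n r. r @ [n]) m = [0..<m]" for m
    by (induction m) simp_all
  ultimately show ?thesis by simp
qed

lemma effective_take:
  assumes "effective f" "effective g"
  shows "effective (\<lambda>x. take (f x) (g x))"
proof -
  have "effective (\<lambda>x. rec_nat [] (\<lambda>i r. case drop i (g x) of [] \<Rightarrow> r | y # _ \<Rightarrow> r @ [y]) (f x))"
    by (intro effective_basic effective_append effective_drop effective_comp[OF assms(2)] assms)
  moreover have "rec_nat [] (\<lambda>i r. case drop i ys of [] \<Rightarrow> r | y # _ \<Rightarrow> r @ [y]) n = take n ys"
    for ys :: "'b list" and n
  proof (induction n)
    case (Suc n)
    then show ?case
      by (cases "n < length ys") (simp_all add: take_Suc_conv_app_nth Cons_nth_drop_Suc[symmetric])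
  qed simp
  ultimately show ?thesis by simp
qed

lemma effective_replicate:
  assumes "effective f" "effective g"
  shows "effective (\<lambda>x. replicate (f x) (g x))"
proof -
  have "effective (\<lambda>x. rec_nat [] (\<lambda>i r. g x # r) (f x))"
    by (intro effective_basic effective_comp[OF assms(2)] assms)
  moreover have "rec_nat [] (\<lambda>i r. c # r) n = replicate n c" for c :: 'b and n
    by (induction n) simp_all
  ultimately show ?thesis by simp
qed

text \<open>Encoding and decoding act as the identity on codes, for lists as well as for
  pairs.\<close>

lemma effective_list_encode: "effective f \<Longrightarrow> effective (\<lambda>x. list_encode (f x))"
  using effective_enc[of f] by (simp add: enc_nat_list)

lemma effective_list_decode: "effective f \<Longrightarrow> effective (\<lambda>x. list_decode (f x))"
  using effective_encD[of "\<lambda>x. list_decode (f x)"] by (simp add: enc_nat_list)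

lemma effective_prod_decode: "effective f \<Longrightarrow> effective (\<lambda>x. prod_decode (f x))"
  using effective_encD[of "\<lambda>x. prod_decode (f x)"] by (simp add: enc_prod_def)

lemmas effective_intros = effective_basic effective_bind effective_the effective_hd effective_drop
  effective_foldl effective_length effective_append effective_map effective_upt effective_take
  effective_replicate effective_list_encode effective_list_decode effective_prod_decode

section \<open>Bounded evaluation of oracle programs\<close>

text \<open>Written as a recursion to make effectivity immediate; its meaning is given by
  \<open>bsearch_eq_Some\<close>.\<close>

definition bsearch :: "(nat \<Rightarrow> bool) \<Rightarrow> nat \<Rightarrow> nat option" where
  "bsearch P n = rec_nat None
     (\<lambda>i r. case r of None \<Rightarrow> if P i then Some i else None | Some j \<Rightarrow> Some j) n"

lemma bsearch_eq_Some: "bsearch P n = Some m \<longleftrightarrow> m < n \<and> P m \<and> (\<forall>i<m. \<not> P i)"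
proof -
  have "bsearch P n = (if \<exists>i<n. P i then Some (LEAST i. P i) else None)"
  proof (induction n)
    case (Suc n)
    have "(LEAST i. P i) = n" if "P n" "\<forall>i<n. \<not> P i"
      using that by (intro Least_equality) (auto simp: not_less[symmetric])
    then show ?case using Suc unfolding bsearch_def by (auto simp: less_Suc_eq)
  qed (simp add: bsearch_def)
  moreover have "(LEAST i. P i) = m" if "P m" "\<forall>i<m. \<not> P i"
    using that by (intro Least_equality) (auto simp: not_less[symmetric])
  moreover have "(LEAST i. P i) < n" if "P i" "i < n" for i
    using Least_le[of P i] that by simp
  ultimately show ?thesis
    by (auto intro: LeastI dest: not_less_Least)
qed

lemma effective_bsearch:
  fixes P :: "'a::coded \<Rightarrow> nat \<Rightarrow> bool"
  assumes P: "effective (\<lambda>p. P (fst p) (snd p))" and h: "effective h"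
  shows "effective (\<lambda>x. bsearch (\<lambda>i. P x i) (h x))"
  unfolding bsearch_def
  by (intro effective_intros h effective_comp2[OF P])

text \<open>Evaluation with a finite piece of the oracle, whose length also bounds every search.\<close>

primrec brun :: "nat list \<Rightarrow> prog \<Rightarrow> nat list \<Rightarrow> nat option" where
  "brun \<sigma> Zero = (\<lambda>xs. Some 0)"
| "brun \<sigma> Succ = (\<lambda>xs. case xs of [] \<Rightarrow> None | x # _ \<Rightarrow> Some (Suc x))"
| "brun \<sigma> (Proj i) = (\<lambda>xs. if i < length xs then Some (xs ! i) else None)"
| "brun \<sigma> Oracle = (\<lambda>xs. case xs of [] \<Rightarrow> None
     | x # _ \<Rightarrow> if x < length \<sigma> then Some (\<sigma> ! x) else None)"
| "brun \<sigma> (Comp p qs) = (\<lambda>xs. Option.bind (those (map (\<lambda>q. brun \<sigma> q xs) qs)) (brun \<sigma> p))"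
| "brun \<sigma> (Prec p q) = (\<lambda>xs. case xs of [] \<Rightarrow> None
     | x # ys \<Rightarrow> rec_nat (brun \<sigma> p ys) (\<lambda>n r. Option.bind r (\<lambda>y. brun \<sigma> q (n # y # ys))) x)"
| "brun \<sigma> (Mu p) = (\<lambda>xs. bsearch (\<lambda>n. brun \<sigma> p (n # xs) = Some 0 \<and>
     (\<forall>m<n. brun \<sigma> p (m # xs) \<noteq> None)) (length \<sigma>))"

lemma those_eq_Some: "those xs = Some ys \<longleftrightarrow> xs = map Some ys"
proof (induction xs arbitrary: ys)
  case (Cons x xs)
  then show ?case by (cases ys) (auto split: option.split)
qed auto

text \<open>The induction hypotheses for \<open>Comp\<close> concern single components that
  converge; this carries convergence over to the vector of their values.\<close>

lemma map_Some_mono: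
  assumes "map f qs = map Some ys" "\<And>q y. q \<in> set qs \<Longrightarrow> f q = Some y \<Longrightarrow> g q = Some y"
  shows "map g qs = map Some ys"
  using assms by (induction qs arbitrary: ys) (auto simp: Cons_eq_map_conv)

lemma effective_those_map:
  assumes "\<And>q. q \<in> set qs \<Longrightarrow> effective (\<lambda>x. f x q)"
  shows "effective (\<lambda>x. those (map (f x) qs))"
  using assms
proof (induction qs)
  case (Cons q qs)
  have *: "those (map (f x) (q # qs)) =
      Option.bind (f x q) (\<lambda>y. Option.bind (those (map (f x) qs)) (\<lambda>ys. Some (y # ys)))" for x
    by (cases "f x q"; cases "those (map (f x) qs)") simp_all
  have "effective (\<lambda>x. those (map (f x) qs))" "effective (\<lambda>x. f x q)"
    using Cons by simp_all
  then show ?case unfolding *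
    by (intro effective_intros effective_comp[OF \<open>effective (\<lambda>x. those (map (f x) qs))\<close>])
qed (simp add: effective_const)

text \<open>Only the oracle string and the arguments vary, so induction on the fixed program works.
  Dependence on an index comes in later through the program \<open>u\<close>.\<close>

lemma effective_brun: "effective (\<lambda>z. brun (fst z) p (snd z))"
proof (induction p)
  case (Proj i)
  \<comment> \<open>Under the guard, indexing is replaced by \<open>hd (drop i xs)\<close>, a term
    covered by the effectivity rules.\<close>
  have *: "(if i < length xs then Some (xs ! i) else None) =
      (if i < length xs then Some (hd (drop i xs)) else None)" for xs :: "nat list"
    by (simp add: hd_drop_conv_nth)
  show ?case unfolding brun.simps * by (intro effective_intros)
next
  case Oracle
  have *: "(if x < length xs then Some (xs ! x) else None) =
      (if x < length xs then Some (hd (drop x xs)) else None)" for x and xs :: "nat list"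
    by (simp add: hd_drop_conv_nth)
  show ?case unfolding brun.simps * by (intro effective_intros)
next
  case (Comp p qs)
  show ?case unfolding brun.simps
    by (intro effective_bind effective_those_map Comp.IH(2) effective_comp2[OF Comp.IH(1)]
        effective_intros)
next
  case (Prec p q)
  show ?case unfolding brun.simps
    by (intro effective_intros effective_comp2[OF Prec.IH(1)] effective_comp2[OF Prec.IH(2)])
next
  case (Mu p)
  show ?case unfolding brun.simps
    by (intro effective_bsearch effective_intros effective_comp2[OF Mu])
qed (unfold brun.simps, (intro effective_intros)+)

section \<open>Monotonicity, soundness and completeness of bounded evaluation\<close>

lemma brun_append: "brun \<sigma> p xs = Some y \<Longrightarrow> brun (\<sigma> @ \<tau>) p xs = Some y"
proof (induction p arbitrary: xs y)
  case (Comp p qs)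
  then obtain ys where ys: "map (\<lambda>q. brun \<sigma> q xs) qs = map Some ys" "brun \<sigma> p ys = Some y"
    by (auto simp: bind_eq_Some_conv those_eq_Some)
  have "map (\<lambda>q. brun (\<sigma> @ \<tau>) q xs) qs = map Some ys"
    using ys(1) by (rule map_Some_mono) (rule Comp.IH)
  then show ?case using Comp.IH(1)[OF ys(2)] by (auto simp: bind_eq_Some_conv those_eq_Some)
next
  case (Prec p q)
  obtain x ys where xs: "xs = x # ys" using Prec.prems by (cases xs) auto
  have "rec_nat (brun (\<sigma> @ \<tau>) p ys) (\<lambda>n r. Option.bind r (\<lambda>y. brun (\<sigma> @ \<tau>) q (n # y # ys))) m = Some z"
    if "rec_nat (brun \<sigma> p ys) (\<lambda>n r. Option.bind r (\<lambda>y. brun \<sigma> q (n # y # ys))) m = Some z" for m z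
    using that by (induction m arbitrary: z) (auto simp: bind_eq_Some_conv intro: Prec.IH)
  then show ?case using Prec.prems by (simp add: xs)
next
  case (Mu p)
  have y: "y < length \<sigma>" "brun \<sigma> p (y # xs) = Some 0" "\<forall>m<y. brun \<sigma> p (m # xs) \<noteq> None"
    and least: "\<forall>i<y. \<not> (brun \<sigma> p (i # xs) = Some 0 \<and> (\<forall>m<i. brun \<sigma> p (m # xs) \<noteq> None))"
    using Mu.prems unfolding brun.simps bsearch_eq_Some by blast+
  \<comment> \<open>Every candidate below \<open>y\<close> has already converged to a nonzero value,
    so a longer oracle string cannot uncover a smaller zero.\<close>
  have "\<exists>z. brun (\<sigma> @ \<tau>) p (m # xs) = Some (Suc z)" if less: "m < y" for m
  proof -
    obtain z where z: "brun \<sigma> p (m # xs) = Some z" using y(3) less by auto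
    moreover have "z \<noteq> 0" using z least y(3) less by auto
    ultimately show ?thesis using Mu.IH by (cases z) auto
  qed
  moreover have "brun (\<sigma> @ \<tau>) p (y # xs) = Some 0" using y(2) Mu.IH by blast
  ultimately show ?case using y(1) by (fastforce simp: bsearch_eq_Some)
qed (auto split: list.splits if_splits simp: nth_append)

text \<open>Every answer that the evaluation takes from \<open>\<sigma>\<close> agrees with
  \<open>g\<close>. A successful search has seen nonzero values at all smaller candidates, so it
  finds the true minimum.\<close>

lemma brun_sound:
  assumes "\<forall>i<length \<sigma>. g i = \<sigma> ! i" "brun \<sigma> p xs = Some y"
  shows "run g p xs = Some y"
  using assms(2)
proof (induction p arbitrary: xs y)
  case (Comp p qs)
  then obtain ys where ys: "map (\<lambda>q. brun \<sigma> q xs) qs = map Some ys" "brun \<sigma> p ys = Some y"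
    by (auto simp: bind_eq_Some_conv those_eq_Some)
  have "map (\<lambda>q. run g q xs) qs = map Some ys"
    using ys(1) by (rule map_Some_mono) (rule Comp.IH)
  then show ?case using Comp.IH(1)[OF ys(2)] by (auto simp: bind_eq_Some_conv those_eq_Some)
next
  case (Prec p q)
  obtain x ys where xs: "xs = x # ys" using Prec.prems by (cases xs) auto
  have "rec_nat (run g p ys) (\<lambda>n r. Option.bind r (\<lambda>y. run g q (n # y # ys))) m = Some z"
    if "rec_nat (brun \<sigma> p ys) (\<lambda>n r. Option.bind r (\<lambda>y. brun \<sigma> q (n # y # ys))) m = Some z" for m z
    using that by (induction m arbitrary: z) (auto simp: bind_eq_Some_conv intro: Prec.IH)
  then show ?case using Prec.prems by (simp add: xs)
next
  case (Mu p)
  have y: "brun \<sigma> p (y # xs) = Some 0" "\<forall>m<y. brun \<sigma> p (m # xs) \<noteq> None"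
    and least: "\<forall>i<y. \<not> (brun \<sigma> p (i # xs) = Some 0 \<and> (\<forall>m<i. brun \<sigma> p (m # xs) \<noteq> None))"
    using Mu.prems unfolding brun.simps bsearch_eq_Some by blast+
  have m: "\<exists>z. run g p (m # xs) = Some (Suc z)" if less: "m < y" for m
  proof -
    obtain z where z: "brun \<sigma> p (m # xs) = Some z" using y(2) less by auto
    moreover have "z \<noteq> 0" using z least y(2) less by auto
    ultimately show ?thesis using Mu.IH by (cases z) auto
  qed
  have 0: "run g p (y # xs) = Some 0" using y(1) Mu.IH by blast
  have "(LEAST n. run g p (n # xs) = Some 0) = y"
  proof (rule Least_equality)
    show "run g p (y # xs) = Some 0" by (rule 0)
    show "y \<le> n" if "run g p (n # xs) = Some 0" for n
      using m[of n] that by (cases "n < y") auto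
  qed
  then show ?case using 0 m by fastforce
qed (use assms(1) in \<open>auto split: list.splits if_splits\<close>)

text \<open>A convergent computation asks finitely many questions and makes finitely many finite
  searches. Stating this for all large \<open>s\<close> lets the bounds for subcomputations be
  combined.\<close>

lemma brun_complete:
  "run g p xs = Some y \<Longrightarrow> \<forall>\<^sub>F s in sequentially. brun (prefix s g) p xs = Some y"
proof (induction p arbitrary: xs y)
  case Oracle
  then obtain x where "xs = x # tl xs" "y = g x" by (cases xs) auto
  then show ?case
    using eventually_gt_at_top[of x]
    by (cases xs) (auto elim!: eventually_mono)
next
  case (Comp p qs)
  then obtain ys where ys: "map (\<lambda>q. run g q xs) qs = map Some ys" "run g p ys = Some y"
    by (auto simp: bind_eq_Some_conv those_eq_Some)
  have "\<forall>\<^sub>F s in sequentially. \<forall>q\<in>set qs. \<forall>y. run g q xs = Some y \<longrightarrow> brun (prefix s g) q xs = Some y"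
  proof (intro eventually_ball_finite ballI)
    fix q assume "q \<in> set qs"
    then show "\<forall>\<^sub>F s in sequentially. \<forall>y. run g q xs = Some y \<longrightarrow> brun (prefix s g) q xs = Some y"
      using Comp.IH(2)[of q xs] by (cases "run g q xs") (auto elim!: eventually_mono)
  qed simp
  then show ?case using Comp.IH(1)[OF ys(2)]
  proof eventually_elim
    case (elim s)
    then have "map (\<lambda>q. brun (prefix s g) q xs) qs = map Some ys"
      by (intro map_Some_mono[OF ys(1)]) blast
    then show ?case using elim by (auto simp: bind_eq_Some_conv those_eq_Some)
  qed
next
  case (Prec p q)
  obtain x ys where xs: "xs = x # ys" using Prec.prems by (cases xs) auto
  have "\<forall>\<^sub>F s in sequentially. rec_nat (brun (prefix s g) p ys)
      (\<lambda>n r. Option.bind r (\<lambda>y. brun (prefix s g) q (n # y # ys))) m = Some z"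
    if "rec_nat (run g p ys) (\<lambda>n r. Option.bind r (\<lambda>y. run g q (n # y # ys))) m = Some z" for m z
    using that
  proof (induction m arbitrary: z)
    case 0
    then show ?case using Prec.IH(1) by simp
  next
    case (Suc m)
    then obtain w where w: "rec_nat (run g p ys) (\<lambda>n r. Option.bind r (\<lambda>y. run g q (n # y # ys))) m = Some w"
      "run g q (m # w # ys) = Some z"
      by (auto simp: bind_eq_Some_conv)
    show ?case using Suc.IH[OF w(1)] Prec.IH(2)[OF w(2)] by eventually_elim simp
  qed
  then show ?case using Prec.prems by (simp add: xs)
next
  case (Mu p)
  obtain n where n: "run g p (n # xs) = Some 0" "\<forall>m<n. run g p (m # xs) \<noteq> None"
    and y: "y = (LEAST n. run g p (n # xs) = Some 0)"
    using Mu.prems by (auto split: if_splits)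
  have 0: "run g p (y # xs) = Some 0"
    using LeastI[of "\<lambda>n. run g p (n # xs) = Some 0", OF n(1)] y by simp
  have "y \<le> n"
    using Least_le[of "\<lambda>n. run g p (n # xs) = Some 0", OF n(1)] y by simp
  then have m: "(\<exists>z. run g p (m # xs) = Some z) \<and> run g p (m # xs) \<noteq> Some 0" if "m < y" for m
    using n(2) that not_less_Least[of m "\<lambda>n. run g p (n # xs) = Some 0"] y by simp
  have "\<forall>\<^sub>F s in sequentially. \<forall>m\<in>{..y}. brun (prefix s g) p (m # xs) = run g p (m # xs)"
  proof (intro eventually_ball_finite ballI)
    fix k assume "k \<in> {..y}"
    then obtain z where "run g p (k # xs) = Some z" using m[of k] 0 by (cases "k = y") auto
    then show "\<forall>\<^sub>F s in sequentially. brun (prefix s g) p (k # xs) = run g p (k # xs)"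
      using Mu.IH by simp
  qed simp
  then show ?case using eventually_gt_at_top[of y]
    by eventually_elim (auto simp: bsearch_eq_Some 0 m)
qed (auto split: list.splits if_splits)

section \<open>Elimination of computable oracles\<close>

lemma run_computable_oracle:
  assumes "computable f"
  shows "\<exists>p'. \<forall>xs. run (\<lambda>_. 0) p' xs = run f p xs"
proof (induction p)
  case Zero
  show ?case by (rule exI[of _ Zero]) simp
next
  case Succ
  show ?case by (rule exI[of _ Succ]) simp
next
  case (Proj i)
  show ?case by (rule exI[of _ "Proj i"]) simp
next
  case Oracle
  obtain q where "\<And>n. run (\<lambda>_. 0) q [n] = Some (f n)"
    using assms unfolding computable_def by blast
  \<comment> \<open>\<open>Proj 0\<close> passes the query on to a program for \<open>f\<close>, and
    diverges on the empty list just as \<open>Oracle\<close> does.\<close>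
  then show ?case by (intro exI[of _ "Comp q [Proj 0]"]) (simp split: list.split)
next
  case (Comp p qs)
  obtain p' where p: "\<And>xs. run (\<lambda>_. 0) p' xs = run f p xs" using Comp by blast
  obtain t where "\<And>q xs. q \<in> set qs \<Longrightarrow> run (\<lambda>_. 0) (t q) xs = run f q xs"
    using Comp(2) by metis
  then have "map (\<lambda>q. run (\<lambda>_. 0) q xs) (map t qs) = map (\<lambda>q. run f q xs) qs" for xs
    by simp
  then show ?case
    by (intro exI[of _ "Comp p' (map t qs)"]) (simp add: p ext[OF p] del: map_map)
next
  case (Prec p q)
  then obtain p' q' where "run (\<lambda>_. 0) p' = run f p" "run (\<lambda>_. 0) q' = run f q"
    by (metis ext)
  then show ?case by (intro exI[of _ "Prec p' q'"]) (simp split: list.split)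
next
  case (Mu p)
  then obtain p' where "\<And>xs. run (\<lambda>_. 0) p' xs = run f p xs"
    by blast
  then show ?case by (intro exI[of _ "Mu p'"]) simp
qed

text \<open>The oracle is eliminated and the index is hardwired by a constant program. This produces
  the computable points that contradict specialness.\<close>

lemma computable_relative:
  assumes "computable f" "\<And>n. run f p [e, n] = Some (h n)"
  shows "computable h"
proof -
  obtain p' where p': "\<And>xs. run (\<lambda>_. 0) p' xs = run f p xs"
    using run_computable_oracle[OF assms(1)] by blast
  obtain c where c: "\<And>xs. length xs = 1 \<Longrightarrow> run (\<lambda>_. 0) c xs = Some e"
    using recfn_const[of 1 e] unfolding recfn_def by blast
  show ?thesis
    unfolding computable_def by (intro exI[of _ "Comp p' [c, Proj 0]"]) (simp add: c p' assms(2))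
qed

section \<open>Strings and leaves\<close>

lemma effective_brun': "effective f \<Longrightarrow> effective g \<Longrightarrow> effective (\<lambda>x. brun (f x) p (g x))"
  by (rule effective_comp2[OF effective_brun])

lemma effective_prod_encode: "effective f \<Longrightarrow> effective (\<lambda>x. prod_encode (f x))"
  using effective_enc[of f] by (simp add: enc_prod_def)

lemma effective_string_set: "computable_string_set R \<Longrightarrow> effective f \<Longrightarrow> effective (\<lambda>x. f x \<in> R)"
proof -
  assume R: "computable_string_set R" and f: "effective f"
  have "enc (\<sigma> \<in> R) = (if \<sigma> \<in> R then 1 else 0)" for \<sigma>
    by (simp add: enc_bool_def)
  then have "effective (\<lambda>\<sigma>. \<sigma> \<in> R)"
    using R effective_encD[of "\<lambda>\<sigma>. \<sigma> \<in> R"]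
    by (simp add: computable_string_set_def effective_on_strings)
  from effective_comp[OF this f] show ?thesis .
qed

lemma computable_string_setI:
  assumes "effective (\<lambda>\<sigma>. \<sigma> \<in> R)"
  shows "computable_string_set R"
proof -
  have "enc (\<sigma> \<in> R) = (if \<sigma> \<in> R then 1 else 0)" for \<sigma>
    by (simp add: enc_bool_def)
  then show ?thesis
    using effective_enc[OF assms] by (simp add: computable_string_set_def effective_on_strings)
qed

lemma take_prefix: "k \<le> n \<Longrightarrow> take k (prefix n f) = prefix k f"
  by (simp add: subsequence_def take_map)

lemma nth_prefix: "i < n \<Longrightarrow> prefix n f ! i = f i"
  by (simp add: subsequence_def)

section \<open>Limits of growing strings, and ranks in infinite sets\<close>

lemma string_chain:
  assumes "\<And>n. \<exists>\<tau>. w (Suc n) = w n @ \<tau>" "m \<le> n"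
  shows "\<exists>\<tau>. w n = w m @ \<tau>"
  using assms(2)
proof (induction rule: dec_induct)
  case (step n)
  then show ?case using assms(1)[of n] by auto
qed simp

text \<open>Entry \<open>i\<close> of the limit is read off the first string longer than
  \<open>i\<close>, with which the later strings agree. The search for this string makes the limit
  computable when the sequence is effective.\<close>

lemma string_limit:
  fixes w :: "nat \<Rightarrow> nat list"
  assumes chain: "\<And>n. \<exists>\<tau>. w (Suc n) = w n @ \<tau>" and unbounded: "\<And>i. \<exists>n. i < length (w n)"
  obtains f where "\<And>n. prefix (length (w n)) f = w n" "effective w \<Longrightarrow> computable f"
proof
  define f where "f i = hd (drop i (w (LEAST n. i < length (w n))))" for i
  have f: "f i = w n ! i" if "i < length (w n)" for i n
  proof -
    let ?m = "LEAST n. i < length (w n)"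
    have m: "i < length (w ?m)" "?m \<le> n"
      using that by (rule LeastI, rule Least_le)
    obtain \<tau> where "w n = w ?m @ \<tau>" using string_chain[of w, OF chain m(2)] by blast
    then have "w n ! i = w ?m ! i" using m(1) by (simp add: nth_append)
    then show ?thesis unfolding f_def using m(1) by (simp add: hd_drop_conv_nth)
  qed
  show "prefix (length (w n)) f = w n" for n
    by (rule nth_equalityI) (simp_all add: f nth_prefix)
  assume w: "effective w"
  have "effective f" unfolding f_def
    by (intro effective_intros effective_comp[OF w] effective_Least unbounded)
  then show "computable f" by (simp add: effective_computable)
qed

lemma ex_count_eq:
  assumes "infinite {c. P c}"
  shows "\<exists>c. P c \<and> count P c = r"
proof -
  \<comment> \<open>The first element from \<open>c\<^sub>0\<close> on has as many predecessors in
    the set as \<open>c\<^sub>0\<close> itself; moving just past an element raises the rank by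
    one.\<close>
  have next_eq: "\<exists>c. P c \<and> count P c = count P c\<^sub>0" for c\<^sub>0
  proof -
    have "\<exists>c. c\<^sub>0 \<le> c \<and> P c"
      using assms by (metis (mono_tags, lifting) infinite_nat_iff_unbounded_le mem_Collect_eq)
    then have c: "c\<^sub>0 \<le> (LEAST c. c\<^sub>0 \<le> c \<and> P c) \<and> P (LEAST c. c\<^sub>0 \<le> c \<and> P c)"
      by (rule LeastI_ex)
    have "i < (LEAST c. c\<^sub>0 \<le> c \<and> P c) \<and> P i \<longleftrightarrow> i < c\<^sub>0 \<and> P i" for i
      using c not_less_Least[of i "\<lambda>c. c\<^sub>0 \<le> c \<and> P c"] by (auto simp: not_le)
    then have "count P (LEAST c. c\<^sub>0 \<le> c \<and> P c) = count P c\<^sub>0" by (simp add: count_def)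
    then show ?thesis using c by blast
  qed
  show ?thesis
  proof (induction r)
    case 0
    then show ?case using next_eq[of 0] by (simp add: count_def)
  next
    case (Suc r)
    then obtain c where "P c" "count P c = r" by blast
    then show ?case using next_eq[of "Suc c"] by (simp add: count_Suc)
  qed
qed

text \<open>An infinite set would have a member with exactly \<open>Suc b\<close> predecessors in
  it.\<close>

lemma finite_if_count_bounded:
  assumes "\<And>j. count P j \<le> b"
  shows "finite {i. P i}"
proof (rule ccontr)
  assume "infinite {i. P i}"
  then obtain c where "count P c = Suc b" using ex_count_eq by blast
  then show False using assms[of c] by simp
qed

lemma count_mono: "i \<le> j \<Longrightarrow> count P i \<le> count P j"
  unfolding count_def by (rule card_mono) auto

text \<open>Otherwise the leftmost path above \<open>\<alpha>\<close> is computable.\<close>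

lemma ex_leaf_above:
  assumes tree: "binary_tree T" and T: "computable_string_set T"
    and no_path: "\<And>f. f \<in> paths T \<Longrightarrow> \<not> computable f" and \<alpha>: "\<alpha> \<in> T"
  shows "\<exists>\<tau>. \<alpha> @ \<tau> \<in> leaves T"
proof (rule ccontr)
  assume no_leaf: "\<nexists>\<tau>. \<alpha> @ \<tau> \<in> leaves T"
  \<comment> \<open>If 0 leads off the tree, then 1 does not: the current node is no leaf, so it has
    a child.\<close>
  define w where "w n = rec_nat \<alpha> (\<lambda>_ \<sigma>. \<sigma> @ [if \<sigma> @ [0] \<in> T then 0 else 1]) n" for n
  have w_Suc: "w (Suc n) = w n @ [if w n @ [0] \<in> T then 0 else 1]" for n
    by (simp add: w_def)
  have "w n \<in> T \<and> (\<exists>\<tau>. w n = \<alpha> @ \<tau>)" for n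
  proof (induction n)
    case 0
    then show ?case using \<alpha> by (simp add: w_def)
  next
    case (Suc n)
    then obtain \<tau> where "w n \<in> T" "w n \<notin> leaves T" using no_leaf by force
    then obtain \<tau> where \<tau>: "w n @ \<tau> \<in> T" "\<tau> \<noteq> []" by (auto simp: leaves_def)
    then obtain x \<tau>' where x: "\<tau> = x # \<tau>'" by (cases \<tau>) auto
    have "(w n @ [x]) @ \<tau>' \<in> T" using \<tau> x by simp
    then have "w n @ [x] \<in> T" using tree unfolding binary_tree_def by blast
    moreover from this have "x \<in> {0, 1}" using tree unfolding binary_tree_def by auto
    ultimately show ?case using Suc by (auto simp: w_Suc)
  qed
  then have w: "w n \<in> T" for n by simp
  have "n \<le> length (w n)" for n by (induction n) (simp_all add: w_Suc)
  then have unbounded: "\<exists>n. i < length (w n)" for i using Suc_le_lessD by blast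
  moreover have "\<exists>\<tau>. w (Suc n) = w n @ \<tau>" for n by (simp add: w_Suc)
  ultimately obtain f where f: "\<And>n. prefix (length (w n)) f = w n" "effective w \<Longrightarrow> computable f"
    using string_limit[of w] by blast
  have "effective w" unfolding w_def
    by (intro effective_intros effective_string_set[OF T])
  moreover have "f \<in> paths T"
    unfolding paths_def mem_Collect_eq
  proof
    fix i
    obtain n where "i < length (w n)" using unbounded by blast
    then have "prefix i f = take i (w n)" using take_prefix[of i "length (w n)" f] by (simp add: f(1))
    then have "prefix i f @ drop i (w n) \<in> T" using w[of n] by simp
    then show "prefix i f \<in> T" using tree unfolding binary_tree_def by blast
  qed
  ultimately show False using no_path f(2) by blast
qed

text \<open>The longer prefix would be a proper extension, within the tree, of the shorter leaf.
  Hence the leaf used in \<open>diag_tree\<close> does not change along a point.\<close>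

lemma leaves_unique:
  assumes "prefix k f \<in> leaves T" "prefix l f \<in> leaves T"
  shows "k = l"
proof -
  have "\<not> k < l" if "prefix k f \<in> leaves T" "prefix l f \<in> leaves T" for k l
  proof
    assume "k < l"
    then have "prefix l f = prefix k f @ drop k (prefix l f)"
      using take_prefix[of k l f] append_take_drop_id[of k "prefix l f"] by simp
    then have "drop k (prefix l f) = []" using that unfolding leaves_def by auto
    then show False using \<open>k < l\<close> by simp
  qed
  then show ?thesis using assms by (meson linorder_neqE_nat)
qed

lemma conc_in_nabla: "\<rho> \<in> leaves T \<Longrightarrow> f \<in> nabla T \<Longrightarrow> \<rho> \<frown> f \<in> nabla T"
proof -
  assume \<rho>: "\<rho> \<in> leaves T" and "f \<in> nabla T"
  then obtain n where "f \<in> (concatenation T ^^ n) (paths T)" unfolding nabla_def by blast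
  then have "\<rho> \<frown> f \<in> (concatenation T ^^ Suc n) (paths T)"
    using \<rho> by (auto simp: concatenation_def)
  then show ?thesis unfolding nabla_def by blast
qed

lemma paths_subset_nabla: "paths T \<subseteq> nabla T"
  unfolding nabla_def using funpow_0[of "concatenation T" "paths T"] by blast

section \<open>Diagonalization above the leaves\<close>

text \<open>The case of the theorem in which \<open>P\<close> has no computable element.
  \<open>T\<close> is the tree of \<open>P\<close>, the strings in \<open>R\<close> define
  \<open>Q\<close>, and \<open>u\<close> computes the enumeration.\<close>

locale diagonalization =
  fixes T R :: "nat list set" and u :: prog
  assumes tree: "binary_tree T" and T: "computable_string_set T" and R: "computable_string_set R"
    and no_path: "f \<in> paths T \<Longrightarrow> \<not> computable f"
    and no_point: "(\<And>n. prefix n f \<in> R) \<Longrightarrow> \<not> computable f"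
    and paths_nonempty: "paths T \<noteq> {}"
begin

text \<open>Learner \<open>a\<close>, applied to the first \<open>i\<close> entries of \<open>\<beta>\<close> and run for \<^term>\<open>length \<beta>\<close> steps;
  the program \<open>u\<close> is universal, and learners use the oracle \<open>0\<close>.\<close>

definition guess :: "nat \<Rightarrow> nat list \<Rightarrow> nat \<Rightarrow> nat option" where
  "guess a \<beta> i = brun (replicate (length \<beta>) 0) u [a, list_encode (take i \<beta>)]"

text \<open>Here \<open>j\<close> is the stage of the conjecture, \<open>m\<close> the required
  progress and \<open>b\<close> the bound on mind changes. All initial segments of the output are
  tested, as \<open>R\<close> may fail to be a tree. All searches are bounded, so the relation is
  decidable.\<close>

definition witness :: "nat \<Rightarrow> nat \<Rightarrow> nat \<Rightarrow> nat list \<Rightarrow> bool" where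
  "witness a b m \<beta> \<longleftrightarrow> (\<exists>j\<le>length \<beta>. m \<le> j \<and> (\<forall>i\<le>j. guess a \<beta> i \<noteq> None) \<and>
     count (\<lambda>i. guess a \<beta> (Suc i) \<noteq> guess a \<beta> i) j \<le> b \<and>
     (\<forall>i\<le>m. brun \<beta> u [the (guess a \<beta> j), i] \<noteq> None) \<and>
     (\<forall>n\<le>Suc m. map (\<lambda>i. the (brun \<beta> u [the (guess a \<beta> j), i])) [0..<n] \<in> R))"

text \<open>The requirement that the leaf \<open>\<rho>\<close> is devoted to, as a code of the pair \<open>(a, b)\<close>.\<close>

definition leaf_index :: "nat list \<Rightarrow> nat" where
  "leaf_index \<rho> = count (\<lambda>c. list_decode c \<in> leaves T) (list_encode \<rho>)"

text \<open>\<open>r\<close> is the pair of a learner index and a bound. The length of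
  \<open>\<sigma>\<close> is the progress required of the witness, so requirements grow with the
  node.\<close>

definition extend :: "nat \<times> nat \<Rightarrow> nat \<Rightarrow> nat list \<Rightarrow> nat list" where
  "extend r s \<sigma> = (if list_decode s \<in> leaves T \<and>
       witness (fst r) (snd r) (length \<sigma>) (\<sigma> @ list_decode s) then \<sigma> @ list_decode s else \<sigma>)"

definition node :: "nat list \<Rightarrow> nat \<Rightarrow> nat list" where
  "node \<rho> s = rec_nat \<rho> (\<lambda>s \<sigma>. extend (prod_decode (leaf_index \<rho>)) s \<sigma>) s"

text \<open>Since stage \<open>s\<close> examines the leaf coded by \<open>s\<close>, all leaves of length less than \<open>n\<close> have been
  examined before stage \<^term>\<open>code_bound n\<close>.  A string of length \<open>n\<close> is compared with the node of that stage,
  and a later extension of this node does not lose a path, because it appends a leaf of length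
  at least \<open>n\<close>.\<close>

definition code_bound :: "nat \<Rightarrow> nat" where
  "code_bound n = rec_nat 0 (\<lambda>_ c. Suc (prod_encode (1, c))) n"

text \<open>The equation says that the two strings are comparable. If \<open>\<alpha>\<close> is not
  longer than \<open>\<sigma>\<close>, the other condition reads \<open>[] \<in> T\<close>.\<close>

definition fits :: "nat list \<Rightarrow> nat list \<Rightarrow> bool" where
  "fits \<alpha> \<sigma> \<longleftrightarrow> take (length \<alpha>) \<sigma> = take (length \<sigma>) \<alpha> \<and> drop (length \<sigma>) \<alpha> \<in> T"

definition diag_tree :: "nat list set" where
  "diag_tree = {\<alpha>. \<alpha> \<in> T \<or> (\<exists>k\<le>length \<alpha>. take k \<alpha> \<in> leaves T \<and>
     fits \<alpha> (node (take k \<alpha>) (code_bound (length \<alpha>))))}"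

definition diag :: "(nat \<Rightarrow> nat) set" where
  "diag = {f. \<forall>n. prefix n f \<in> diag_tree}"

section \<open>Decidability of the construction\<close>

lemma T_prefix: "\<sigma> @ \<tau> \<in> T \<Longrightarrow> \<sigma> \<in> T"
  using tree unfolding binary_tree_def by blast

lemma T_binary: "\<sigma> \<in> T \<Longrightarrow> set \<sigma> \<subseteq> {0, 1}"
  using tree unfolding binary_tree_def by auto

text \<open>In a binary tree the two children decide whether a node is a leaf, so an unbounded
  quantifier becomes a decidable condition.\<close>

lemma leaves_iff: "\<sigma> \<in> leaves T \<longleftrightarrow> \<sigma> \<in> T \<and> \<sigma> @ [0] \<notin> T \<and> \<sigma> @ [1] \<notin> T"
proof
  assume "\<sigma> \<in> T \<and> \<sigma> @ [0] \<notin> T \<and> \<sigma> @ [1] \<notin> T"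
  moreover have "\<sigma> @ [x] \<in> T \<and> (x = 0 \<or> x = 1)" if "\<sigma> @ x # \<tau> \<in> T" for x \<tau>
    using T_prefix[of "\<sigma> @ [x]" \<tau>] T_binary[of "\<sigma> @ x # \<tau>"] that by auto
  ultimately have "\<tau> = []" if "\<sigma> @ \<tau> \<in> T" for \<tau>
    using that by (cases \<tau>) blast+
  then show "\<sigma> \<in> leaves T" using \<open>\<sigma> \<in> T \<and> _\<close> unfolding leaves_def by blast
qed (auto simp: leaves_def)

lemma effective_leaves: "effective f \<Longrightarrow> effective (\<lambda>x. f x \<in> leaves T)"
  unfolding leaves_iff by (intro effective_intros effective_string_set[OF T])

lemma effective_guess:
  "effective f \<Longrightarrow> effective g \<Longrightarrow> effective h \<Longrightarrow> effective (\<lambda>x. guess (f x) (g x) (h x))"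
  unfolding guess_def by (intro effective_brun' effective_intros)

lemma effective_witness:
  assumes "effective f" "effective g" "effective h" "effective k"
  shows "effective (\<lambda>x. witness (f x) (g x) (h x) (k x))"
  unfolding witness_def
  by (intro effective_brun' effective_guess effective_intros effective_string_set[OF R]
      effective_comp[OF assms(1)] effective_comp[OF assms(2)] effective_comp[OF assms(3)]
      effective_comp[OF assms(4)])

lemma effective_node:
  assumes "effective f" "effective g"
  shows "effective (\<lambda>x. node (f x) (g x))"
  unfolding node_def extend_def leaf_index_def
  by (intro effective_leaves effective_witness effective_intros effective_comp[OF assms(1)]
      effective_comp[OF assms(2)])

lemma pi01_diag: "pi01 diag"
proof -
  have "effective (\<lambda>\<alpha>. \<alpha> \<in> diag_tree)"
    unfolding diag_tree_def fits_def code_bound_def mem_Collect_eq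
    by (intro effective_leaves effective_node effective_intros effective_prod_encode
        effective_string_set[OF T])
  then show ?thesis unfolding pi01_def diag_def by (blast intro: computable_string_setI)
qed

section \<open>The process above each leaf stops\<close>

lemma guess_sound:
  assumes "guess a \<beta> i = Some v" "prefix (length \<beta>) f = \<beta>" "i \<le> length \<beta>"
  shows "run (\<lambda>_. 0) u [a, list_encode (prefix i f)] = Some v"
proof -
  have "take i \<beta> = prefix i f"
    using take_prefix[OF assms(3), of f] by (simp add: assms(2))
  then have "brun (replicate (length \<beta>) 0) u [a, list_encode (prefix i f)] = Some v"
    using assms(1) by (simp add: guess_def)
  then show ?thesis by (rule brun_sound[rotated]) simp
qed

lemma node_0: "node \<rho> 0 = \<rho>"
  by (simp add: node_def)

lemma node_Suc: "node \<rho> (Suc s) = extend (prod_decode (leaf_index \<rho>)) s (node \<rho> s)"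
  by (simp add: node_def)

lemma node_mono: "s \<le> t \<Longrightarrow> \<exists>\<tau>. node \<rho> t = node \<rho> s @ \<tau>"
  by (rule string_chain[where w = "node \<rho>"]) (simp_all add: node_Suc extend_def)

lemma node_stabilizes: "\<exists>s\<^sub>0. \<forall>s\<ge>s\<^sub>0. node \<rho> s = node \<rho> s\<^sub>0"
proof (rule ccontr)
  assume no: "\<not> ?thesis"
  obtain a b where ab: "prod_decode (leaf_index \<rho>) = (a, b)" by fastforce
  have change: "\<exists>s\<ge>s\<^sub>0. node \<rho> (Suc s) \<noteq> node \<rho> s" for s\<^sub>0
  proof (rule ccontr)
    assume same: "\<not> (\<exists>s\<ge>s\<^sub>0. node \<rho> (Suc s) \<noteq> node \<rho> s)"
    have "node \<rho> s = node \<rho> s\<^sub>0" if "s\<^sub>0 \<le> s" for s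
      using that by (induction rule: dec_induct) (use same in auto)
    then show False using no by blast
  qed
  have chain: "\<exists>\<tau>. node \<rho> (Suc n) = node \<rho> n @ \<tau>" for n by (rule node_mono) simp
  have unbounded: "\<exists>n. i < length (node \<rho> n)" for i
  proof (induction i)
    case 0
    obtain s where "node \<rho> (Suc s) \<noteq> node \<rho> s" using change by blast
    then have "0 < length (node \<rho> (Suc s))" using chain[of s] by auto
    then show ?case by blast
  next
    case (Suc i)
    then obtain n where n: "i < length (node \<rho> n)" by blast
    obtain s where s: "n \<le> s" "node \<rho> (Suc s) \<noteq> node \<rho> s" using change by blast
    obtain \<tau> \<tau>' where "node \<rho> s = node \<rho> n @ \<tau>" "node \<rho> (Suc s) = node \<rho> s @ \<tau>'"
      using node_mono[OF s(1)] chain by blast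
    moreover from this s have "\<tau>' \<noteq> []" by auto
    ultimately have "Suc i < length (node \<rho> (Suc s))" using n by (cases \<tau>') auto
    then show ?case by blast
  qed
  obtain f where f: "\<And>n. prefix (length (node \<rho> n)) f = node \<rho> n"
    and "effective (node \<rho>) \<Longrightarrow> computable f"
    using string_limit[of "node \<rho>"] chain unbounded by blast
  moreover have "effective (node \<rho>)"
    using effective_node[OF effective_const effective_id] .
  ultimately have f_computable: "computable f" by simp
  \<comment> \<open>The node changes only when a witness is found. The string that shows it is the
    new node, an initial segment of \<open>f\<close>, and the old node is as long as
    desired.\<close>
  have step: "\<exists>m\<ge>l. \<exists>\<beta>. witness a b m \<beta> \<and> prefix (length \<beta>) f = \<beta>" for l
  proof -
    obtain n where n: "l < length (node \<rho> n)" using unbounded by blast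
    obtain s where s: "n \<le> s" "node \<rho> (Suc s) \<noteq> node \<rho> s" using change by blast
    obtain \<tau> where "node \<rho> s = node \<rho> n @ \<tau>" using node_mono[OF s(1)] by blast
    then have "l \<le> length (node \<rho> s)" using n by simp
    moreover have "witness a b (length (node \<rho> s)) (node \<rho> (Suc s))"
      using s(2) by (auto simp: node_Suc extend_def ab split: if_splits)
    ultimately show ?thesis using f by blast
  qed
  \<comment> \<open>The actual values of the learner along \<open>f\<close>; the bounded guesses
    agree with them up to the stage \<open>j\<close> of a witness.\<close>
  define \<Psi> where "\<Psi> i = run (\<lambda>_. 0) u [a, list_encode (prefix i f)]" for i
  have stage: "\<exists>m j \<beta>. l \<le> m \<and> m \<le> j \<and> prefix (length \<beta>) f = \<beta> \<and> (\<forall>i\<le>j. \<Psi> i \<noteq> None) \<and>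
      count (\<lambda>i. \<Psi> (Suc i) \<noteq> \<Psi> i) j \<le> b \<and> (\<forall>i\<le>m. brun \<beta> u [the (\<Psi> j), i] \<noteq> None) \<and>
      (\<forall>n\<le>Suc m. map (\<lambda>i. the (brun \<beta> u [the (\<Psi> j), i])) [0..<n] \<in> R)" for l
  proof -
    obtain m \<beta> where m: "l \<le> m" "witness a b m \<beta>" and \<beta>: "prefix (length \<beta>) f = \<beta>"
      using step by blast
    obtain j where j: "j \<le> length \<beta>" "m \<le> j" "\<forall>i\<le>j. guess a \<beta> i \<noteq> None"
      "count (\<lambda>i. guess a \<beta> (Suc i) \<noteq> guess a \<beta> i) j \<le> b"
      "\<forall>i\<le>m. brun \<beta> u [the (guess a \<beta> j), i] \<noteq> None"
      "\<forall>n\<le>Suc m. map (\<lambda>i. the (brun \<beta> u [the (guess a \<beta> j), i])) [0..<n] \<in> R"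
      using m(2) unfolding witness_def by blast
    have \<Psi>: "\<Psi> i = guess a \<beta> i \<and> \<Psi> i \<noteq> None" if "i \<le> j" for i
    proof -
      have "i \<le> length \<beta>" "guess a \<beta> i \<noteq> None" using that j by auto
      then show ?thesis using guess_sound[OF _ \<beta>] unfolding \<Psi>_def by auto
    qed
    then have "count (\<lambda>i. \<Psi> (Suc i) \<noteq> \<Psi> i) j = count (\<lambda>i. guess a \<beta> (Suc i) \<noteq> guess a \<beta> i) j"
      unfolding count_def by (intro arg_cong[where f = card]) auto
    then have "count (\<lambda>i. \<Psi> (Suc i) \<noteq> \<Psi> i) j \<le> b" using j(4) by simp
    moreover have "\<forall>i\<le>j. \<Psi> i \<noteq> None" using \<Psi> by blast
    moreover have "guess a \<beta> j = \<Psi> j" using \<Psi>[of j] by simp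
    ultimately show ?thesis
      using m(1) j(2) \<beta> j(5,6)[unfolded \<open>guess a \<beta> j = \<Psi> j\<close>] by blast
  qed
  \<comment> \<open>Witnesses reach arbitrarily late stages and counts are monotone, so the bound
    holds at every \<open>l\<close>.\<close>
  have "count (\<lambda>i. \<Psi> (Suc i) \<noteq> \<Psi> i) l \<le> b" for l
  proof -
    obtain j where "l \<le> j" "count (\<lambda>i. \<Psi> (Suc i) \<noteq> \<Psi> i) j \<le> b"
      using stage[of l] le_trans by blast
    then show ?thesis using count_mono[of l j "\<lambda>i. \<Psi> (Suc i) \<noteq> \<Psi> i"] by simp
  qed
  then have "finite {i. \<Psi> (Suc i) \<noteq> \<Psi> i}" by (rule finite_if_count_bounded)
  then obtain N where N: "\<forall>i\<in>{i. \<Psi> (Suc i) \<noteq> \<Psi> i}. i < N"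
    unfolding finite_nat_set_iff_bounded by blast
  have \<Psi>_N: "\<Psi> i = \<Psi> N" if "N \<le> i" for i
    using that
  proof (induction rule: dec_induct)
    case (step n)
    then have "\<Psi> (Suc n) = \<Psi> n" using N leD by blast
    then show ?case using step by simp
  qed simp
  define e where "e = the (\<Psi> N)"
  have approx: "\<exists>m \<beta>. l \<le> m \<and> prefix (length \<beta>) f = \<beta> \<and> (\<forall>i\<le>m. brun \<beta> u [e, i] \<noteq> None) \<and>
      (\<forall>n\<le>Suc m. map (\<lambda>i. the (brun \<beta> u [e, i])) [0..<n] \<in> R)" for l
  proof -
    \<comment> \<open>Taking \<open>max l N\<close> puts the stage past the last mind change, so the
      tested conjecture is the final one, \<open>e\<close>.\<close>
    obtain m j \<beta> where j: "max l N \<le> m" "m \<le> j" "prefix (length \<beta>) f = \<beta>"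
      "\<forall>i\<le>m. brun \<beta> u [the (\<Psi> j), i] \<noteq> None"
      "\<forall>n\<le>Suc m. map (\<lambda>i. the (brun \<beta> u [the (\<Psi> j), i])) [0..<n] \<in> R"
      using stage[of "max l N"] by (elim exE conjE) (rule that)
    have "the (\<Psi> j) = e" unfolding e_def using \<Psi>_N[of j] j(1,2) by simp
    moreover have "l \<le> m" using j(1) by simp
    ultimately show ?thesis using j(3-5) by blast
  qed
  have sound: "run f u [e, i] = Some (the (brun \<beta> u [e, i]))"
    if "prefix (length \<beta>) f = \<beta>" "brun \<beta> u [e, i] \<noteq> None" for \<beta> i
  proof (rule brun_sound[of \<beta>])
    show "\<forall>i<length \<beta>. f i = \<beta> ! i"
      using that(1) nth_prefix[of _ "length \<beta>" f] by simp
  qed (use that(2) in auto)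
  \<comment> \<open>The output of conjecture \<open>e\<close> on the computable oracle
    \<open>f\<close>. Arbitrarily long pieces of it have been seen and tested against
    \<open>R\<close>.\<close>
  define h where "h i = the (run f u [e, i])" for i
  have "run f u [e, i] = Some (h i)" for i
    using approx[of i] sound unfolding h_def by (metis option.sel)
  then have "computable h" using computable_relative[OF f_computable] by blast
  moreover have "prefix n h \<in> R" for n
  proof -
    obtain m \<beta> where m: "n \<le> m" "prefix (length \<beta>) f = \<beta>" "\<forall>i\<le>m. brun \<beta> u [e, i] \<noteq> None"
      "\<forall>n\<le>Suc m. map (\<lambda>i. the (brun \<beta> u [e, i])) [0..<n] \<in> R"
      using approx[of n] by blast
    have "prefix n h = map (\<lambda>i. the (brun \<beta> u [e, i])) [0..<n]"
      unfolding subsequence_def h_def using m(1,3) sound[OF m(2)] by simp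
    then show ?thesis using m(1,4) by simp
  qed
  ultimately show False using no_point by blast
qed

section \<open>Abundance of leaves\<close>

lemma leaf_above: "\<alpha> \<in> T \<Longrightarrow> \<exists>\<tau>. \<alpha> @ \<tau> \<in> leaves T"
  using ex_leaf_above[OF tree T] no_path by blast

text \<open>Lets a leaf stand in for a path in any computation that uses only a finite part of the
  path.\<close>

lemma leaf_along:
  assumes "h \<in> paths T"
  obtains \<tau> where "\<tau> \<in> leaves T" "take m \<tau> = prefix m h" "m \<le> length \<tau>"
proof -
  have "prefix m h \<in> T" using assms unfolding paths_def by blast
  then obtain \<tau> where "prefix m h @ \<tau> \<in> leaves T" using leaf_above by blast
  then show thesis using that[of "prefix m h @ \<tau>"] by simp
qed

lemma infinite_leaves: "infinite {c. list_decode c \<in> leaves T}"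
  unfolding infinite_nat_iff_unbounded_le
proof
  fix m
  obtain h where "h \<in> paths T" using paths_nonempty by blast
  then obtain \<tau> where "\<tau> \<in> leaves T" "m \<le> length \<tau>" using leaf_along by metis
  moreover from this(2) have "m \<le> list_encode \<tau>" using length_le_list_encode order_trans by blast
  ultimately show "\<exists>n\<ge>m. n \<in> {c. list_decode c \<in> leaves T}"
    by (intro exI[of _ "list_encode \<tau>"]) simp
qed

text \<open>Ranks in an infinite set take every value, so each pair of a learner and a bound gets a
  leaf.\<close>

lemma ex_leaf_index: "\<exists>\<rho>\<in>leaves T. leaf_index \<rho> = r"
  using ex_count_eq[OF infinite_leaves, of r] unfolding leaf_index_def
  by (metis list_decode_inverse)

section \<open>Codes of binary strings\<close>

lemma code_bound_Suc: "code_bound (Suc n) = Suc (prod_encode (1, code_bound n))"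
  by (simp add: code_bound_def)

lemma code_bound_mono: "m \<le> n \<Longrightarrow> code_bound m \<le> code_bound n"
  by (induction rule: dec_induct)
    (auto simp: code_bound_Suc intro: order_trans[OF _ le_SucI[OF le_prod_encode_2]])

lemma le_code_bound: "n \<le> code_bound n"
  by (induction n) (auto simp: code_bound_Suc intro: order_trans[OF _ le_prod_encode_2])

text \<open>\<open>code_bound n\<close> is the code of the string of \<open>n\<close> ones, the
  largest code of a binary string of this length, because pairing is monotone.\<close>

lemma list_encode_le: "set \<tau> \<subseteq> {0, 1} \<Longrightarrow> list_encode \<tau> \<le> code_bound (length \<tau>)"
  by (induction \<tau>) (auto simp: code_bound_Suc intro!: prod_encode_mono)

lemma length_ge_if_code_ge:
  assumes "\<tau> \<in> leaves T" "code_bound n \<le> list_encode \<tau>"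
  shows "n \<le> length \<tau>"
proof (rule ccontr)
  assume "\<not> n \<le> length \<tau>"
  then have "code_bound (Suc (length \<tau>)) \<le> list_encode \<tau>"
    using code_bound_mono[of "Suc (length \<tau>)" n] assms(2) by simp
  moreover have "list_encode \<tau> \<le> code_bound (length \<tau>)"
    using assms(1) T_binary by (intro list_encode_le) (auto simp: leaves_def)
  moreover have "code_bound (length \<tau>) < code_bound (Suc (length \<tau>))"
    unfolding code_bound_Suc using le_prod_encode_2 le_imp_less_Suc by blast
  ultimately show False by simp
qed

section \<open>The points of the constructed class\<close>

lemma conc_in_diag:
  assumes \<rho>: "\<rho> \<in> leaves T" and final: "\<forall>s\<ge>s\<^sub>0. node \<rho> s = node \<rho> s\<^sub>0" and h: "h \<in> paths T"
  shows "node \<rho> s\<^sub>0 \<frown> h \<in> diag"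
  unfolding diag_def mem_Collect_eq
proof
  fix n
  let ?f = "node \<rho> s\<^sub>0 \<frown> h"
  obtain \<kappa> where \<kappa>: "node \<rho> s\<^sub>0 = \<rho> @ \<kappa>" using node_mono[of 0 s\<^sub>0 \<rho>] by (auto simp: node_0)
  show "prefix n ?f \<in> diag_tree"
  proof (cases "n < length \<rho>")
    case True
    then have "prefix n ?f = take n \<rho>" by (simp add: \<kappa>)
    then have "prefix n ?f \<in> T"
      using T_prefix[of "take n \<rho>" "drop n \<rho>"] \<rho> by (simp add: leaves_def)
    then show ?thesis by (simp add: diag_tree_def)
  next
    case False
    then have n: "length \<rho> \<le> n" by simp
    then have "take (length \<rho>) (prefix n ?f) = \<rho>"
      by (simp add: take_prefix \<kappa>)
    moreover have "fits (prefix n ?f) (node \<rho> (code_bound n))"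
    proof (cases "node \<rho> (code_bound n) = node \<rho> s\<^sub>0")
      case True
      have "prefix i h \<in> T" for i using h unfolding paths_def by blast
      moreover have "[] \<in> T" using T_prefix[of "[]" \<rho>] \<rho> by (simp add: leaves_def)
      ultimately show ?thesis
        unfolding fits_def True by (cases "n \<le> length (node \<rho> s\<^sub>0)") simp_all
    next
      case False
      let ?\<sigma> = "node \<rho> (code_bound n)"
      \<comment> \<open>The first change from stage \<open>code_bound n\<close> on. The leaf
        appended there has length at least \<open>n\<close>, so the first \<open>n\<close> entries
        are settled by \<open>?\<sigma>\<close> and this leaf.\<close>
      have "\<exists>s\<ge>code_bound n. node \<rho> s = ?\<sigma> \<and> node \<rho> (Suc s) \<noteq> ?\<sigma>"
      proof (rule ccontr)
        assume stay: "\<not> ?thesis"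
        have "node \<rho> s = ?\<sigma>" if "code_bound n \<le> s" for s
          using that by (induction rule: dec_induct) (use stay in auto)
        from this[of "max s\<^sub>0 (code_bound n)"] show False
          using False final[rule_format, of "max s\<^sub>0 (code_bound n)"] by simp
      qed
      then obtain s where s: "code_bound n \<le> s" "node \<rho> s = ?\<sigma>" "node \<rho> (Suc s) \<noteq> ?\<sigma>" by blast
      then have \<tau>: "list_decode s \<in> leaves T" "node \<rho> (Suc s) = ?\<sigma> @ list_decode s"
        by (auto simp: node_Suc extend_def split: if_splits)
      have "n \<le> length (list_decode s)"
        using length_ge_if_code_ge[OF \<tau>(1)] s(1) by simp
      moreover obtain \<tau>' where "node \<rho> s\<^sub>0 = ?\<sigma> @ list_decode s @ \<tau>'"
      proof -
        have "node \<rho> (max s\<^sub>0 (Suc s)) = node \<rho> s\<^sub>0"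
          using final[rule_format, of "max s\<^sub>0 (Suc s)"] by simp
        then show thesis using node_mono[of "Suc s" "max s\<^sub>0 (Suc s)" \<rho>] \<tau>(2) that by auto
      qed
      ultimately have "prefix n ?f = take n (?\<sigma> @ list_decode s)" by simp
      moreover have "take i (list_decode s) \<in> T" for i
        using T_prefix[of "take i (list_decode s)" "drop i (list_decode s)"] \<tau>(1)
        by (simp add: leaves_def)
      moreover from this[of 0] have "[] \<in> T" by simp
      moreover have "min (length (list_decode s)) (n - length ?\<sigma>) = n - length ?\<sigma>"
        using \<open>n \<le> length (list_decode s)\<close> by simp
      ultimately show ?thesis
        unfolding fits_def by (cases "n \<le> length ?\<sigma>") simp_all
    qed
    ultimately show ?thesis
      unfolding diag_tree_def mem_Collect_eq using n \<rho>
      by (intro disjI2 exI[of _ "length \<rho>"]) simp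
  qed
qed

text \<open>Every appended string is a leaf. The tail \<open>f\<close> is generalized so that the
  most recent leaf can be absorbed into it.\<close>

lemma node_conc_in_nabla:
  assumes "\<rho> \<in> leaves T"
  shows "f \<in> nabla T \<Longrightarrow> node \<rho> s \<frown> f \<in> nabla T"
proof (induction s arbitrary: f)
  case 0
  then show ?case using conc_in_nabla[OF assms] by (simp add: node_0)
next
  case (Suc s)
  then show ?case using Suc.IH[of "list_decode s \<frown> f"] conc_in_nabla[of "list_decode s" T f]
    by (auto simp: node_Suc extend_def)
qed

text \<open>A point that is not a path leaves \<open>T\<close> for good, and then a single leaf
  accounts for its prefixes. The point follows the final node above that leaf, and what remains is a
  path.\<close>

lemma diag_subset_nabla: "diag \<subseteq> nabla T"
proof
  fix f assume f: "f \<in> diag"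
  show "f \<in> nabla T"
  proof (cases "f \<in> paths T")
    case True
    then show ?thesis using paths_subset_nabla by blast
  next
    case False
    then obtain n\<^sub>0 where n\<^sub>0: "prefix n\<^sub>0 f \<notin> T" unfolding paths_def by blast
    have notin: "prefix n f \<notin> T" if "n\<^sub>0 \<le> n" for n
      using n\<^sub>0 T_prefix[of "prefix n\<^sub>0 f" "drop n\<^sub>0 (prefix n f)"] take_prefix[OF that, of f]
        append_take_drop_id[of n\<^sub>0 "prefix n f"] by auto
    have ex: "\<exists>k. prefix k f \<in> leaves T \<and> fits (prefix n f) (node (prefix k f) (code_bound n))"
      if "n\<^sub>0 \<le> n" for n
    proof -
      have "prefix n f \<in> diag_tree" using f by (simp add: diag_def)
      then show ?thesis using notin[OF that] take_prefix[of _ n f] unfolding diag_tree_def by auto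
    qed
    from ex[of n\<^sub>0] obtain k where k: "prefix k f \<in> leaves T" by blast
    have fits: "fits (prefix n f) (node (prefix k f) (code_bound n))" if "n\<^sub>0 \<le> n" for n
      using ex[OF that] leaves_unique[OF k] by blast
    obtain s\<^sub>0 where s\<^sub>0: "\<forall>s\<ge>s\<^sub>0. node (prefix k f) s = node (prefix k f) s\<^sub>0"
      using node_stabilizes by blast
    let ?\<sigma> = "node (prefix k f) s\<^sub>0"
    \<comment> \<open>The stage \<open>code_bound n\<close> is at least \<open>n\<close>, hence at
      least \<open>s\<^sub>0\<close>, so the node compared is the final one.\<close>
    have large: "fits (prefix n f) ?\<sigma>" if "n\<^sub>0 \<le> n" "s\<^sub>0 \<le> n" for n
      using fits[OF that(1)] s\<^sub>0 le_code_bound[of n] that(2) order_trans by metis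
    let ?l = "length ?\<sigma>"
    have "prefix ?l f = ?\<sigma>"
    proof -
      let ?n = "n\<^sub>0 + s\<^sub>0 + ?l"
      have "take ?n ?\<sigma> = take ?l (prefix ?n f)" using large[of ?n] by (simp add: fits_def)
      then show ?thesis using take_prefix[of ?l ?n f] by simp
    qed
    then have f_eq: "f = ?\<sigma> \<frown> suffix ?l f" using prefix_suffix[of f ?l] by simp
    have "prefix i (suffix ?l f) \<in> T" for i
    proof -
      let ?n = "n\<^sub>0 + s\<^sub>0 + ?l + i"
      have "drop ?l (prefix ?n f) \<in> T" using large[of ?n] by (simp add: fits_def)
      moreover have "take i (drop ?l (prefix ?n f)) = prefix i (suffix ?l f)"
        by (rule nth_equalityI) (simp_all add: nth_prefix add.commute)
      ultimately show ?thesis using T_prefix append_take_drop_id by metis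
    qed
    then have "suffix ?l f \<in> paths T" by (simp add: paths_def)
    then show ?thesis using node_conc_in_nabla[OF k] paths_subset_nabla f_eq by (metis subsetD)
  qed
qed

section \<open>Failure of every learner\<close>

lemma diag_not_learnable:
  assumes \<Psi>: "\<And>\<sigma>. run (\<lambda>_. 0) u [a, list_encode \<sigma>] = Some (\<Psi> \<sigma>)"
    and learns: "\<And>g. g \<in> diag \<Longrightarrow> \<exists>e q. (\<lambda>n. \<Psi> (prefix n g)) \<longlonglongrightarrow> e \<and>
      (\<forall>i. run g u [e, i] = Some (q i)) \<and> (\<forall>n. prefix n q \<in> R)"
    and bounded: "\<And>g. g \<in> diag \<Longrightarrow> finite (mind_changes \<Psi> g) \<and> card (mind_changes \<Psi> g) \<le> b"
  shows False
proof -
  obtain \<rho> where \<rho>: "\<rho> \<in> leaves T" "leaf_index \<rho> = prod_encode (a, b)"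
    using ex_leaf_index by blast
  obtain s\<^sub>0 where s\<^sub>0: "\<forall>s\<ge>s\<^sub>0. node \<rho> s = node \<rho> s\<^sub>0" using node_stabilizes by blast
  define \<sigma> where "\<sigma> = node \<rho> s\<^sub>0"
  obtain h where h: "h \<in> paths T" using paths_nonempty by blast
  define g where "g = \<sigma> \<frown> h"
  have g: "g \<in> diag" unfolding g_def \<sigma>_def by (rule conc_in_diag[OF \<rho>(1) s\<^sub>0 h])
  obtain e q where e: "(\<lambda>n. \<Psi> (prefix n g)) \<longlonglongrightarrow> e" and q: "\<And>i. run g u [e, i] = Some (q i)"
    and q_R: "\<And>n. prefix n q \<in> R"
    using learns[OF g] by blast
  from e obtain N where N: "\<And>n. N \<le> n \<Longrightarrow> \<Psi> (prefix n g) = e"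
    unfolding tendsto_discrete eventually_sequentially by blast
  \<comment> \<open>Late enough for the conjecture to have settled on \<open>e\<close>, and past
    \<open>\<sigma>\<close> as a witness requires.\<close>
  define j where "j = max N (length \<sigma>)"
  \<comment> \<open>One \<open>m\<close> bounds all the finitely many computations that the witness
    quotes. Exceeding \<open>j\<close> and \<open>s\<^sub>0\<close> makes the leaf chosen next
    nonempty, long enough to contain stage \<open>j\<close>, and still untried at stage
    \<open>s\<^sub>0\<close>.\<close>
  have "\<forall>\<^sub>F m in sequentially.
      (\<forall>i\<in>{..j}. brun (prefix m (\<lambda>_. 0)) u [a, list_encode (prefix i g)] = Some (\<Psi> (prefix i g))) \<and>
      (\<forall>i\<in>{..length \<sigma>}. brun (prefix m g) u [e, i] = Some (q i)) \<and> Suc (max j s\<^sub>0) \<le> m"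
    by (intro eventually_conj eventually_ball_finite ballI brun_complete \<Psi> q eventually_ge_at_top)
      simp_all
  then obtain m where
    m_guess: "\<And>i. i \<le> j \<Longrightarrow>
      brun (prefix m (\<lambda>_. 0)) u [a, list_encode (prefix i g)] = Some (\<Psi> (prefix i g))" and
    m_q: "\<And>i. i \<le> length \<sigma> \<Longrightarrow> brun (prefix m g) u [e, i] = Some (q i)" and
    m: "Suc (max j s\<^sub>0) \<le> m"
    unfolding eventually_sequentially by (metis atMost_iff order_refl)
  obtain \<tau> where \<tau>: "\<tau> \<in> leaves T" "take m \<tau> = prefix m h" "m \<le> length \<tau>"
    using leaf_along[OF h] by blast
  define \<beta> where "\<beta> = \<sigma> @ \<tau>"
  have take_\<beta>: "take i \<beta> = prefix i g" if "i \<le> m" for i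
  proof -
    have "take i \<beta> = take i (\<sigma> @ take m \<tau>)"
      using that unfolding \<beta>_def by simp
    also have "\<sigma> @ take m \<tau> = prefix (length \<sigma> + m) g"
      unfolding \<tau>(2) g_def by simp
    also have "take i \<dots> = prefix i g" using that by (intro take_prefix) simp
    finally show ?thesis .
  qed
  have guess: "guess a \<beta> i = Some (\<Psi> (prefix i g))" if "i \<le> j" for i
  proof -
    \<comment> \<open>The zero oracle of \<open>guess\<close> is as long as \<open>\<beta>\<close>,
      so it extends the piece of length \<open>m\<close> for which convergence is known.\<close>
    have "replicate (length \<beta>) 0 = prefix m (\<lambda>_. 0) @ replicate (length \<beta> - m) (0::nat)"
      using \<tau>(3) by (intro nth_equalityI) (auto simp: \<beta>_def nth_append nth_prefix)
    then show ?thesis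
      using brun_append[OF m_guess[OF that]] take_\<beta>[of i] that m by (simp add: guess_def)
  qed
  have brun: "brun \<beta> u [e, i] = Some (q i)" if "i \<le> length \<sigma>" for i
    using brun_append[OF m_q[OF that], of "drop m \<beta>"] take_\<beta>[of m, symmetric] by simp
  have guess_j: "guess a \<beta> j = Some e" using guess[of j] N[of j] by (simp add: j_def)
  have "count (\<lambda>i. guess a \<beta> (Suc i) \<noteq> guess a \<beta> i) j \<le> card (mind_changes \<Psi> g)"
    unfolding count_def
    using bounded[OF g] by (intro card_mono) (auto simp: guess mind_changes_def)
  then have "count (\<lambda>i. guess a \<beta> (Suc i) \<noteq> guess a \<beta> i) j \<le> b" using bounded[OF g] by simp
  moreover have "map (\<lambda>i. the (brun \<beta> u [e, i])) [0..<n] \<in> R" if "n \<le> Suc (length \<sigma>)" for n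
  proof -
    have "map (\<lambda>i. the (brun \<beta> u [e, i])) [0..<n] = prefix n q"
      using that by (simp add: subsequence_def brun)
    then show ?thesis using q_R by simp
  qed
  moreover have "j \<le> length \<beta>" "length \<sigma> \<le> j"
    using m \<tau>(3) by (simp_all add: \<beta>_def j_def)
  ultimately have "witness a b (length \<sigma>) \<beta>"
    unfolding witness_def using guess brun guess_j by (intro exI[of _ j]) simp
  moreover have "node \<rho> s = \<sigma>" if "s\<^sub>0 \<le> s" for s using s\<^sub>0[rule_format, OF that] by (simp add: \<sigma>_def)
  moreover have "s\<^sub>0 \<le> list_encode \<tau>"
    using m \<tau>(3) length_le_list_encode[of \<tau>] by simp
  \<comment> \<open>The stage that is the code of \<open>\<tau>\<close> would append
    \<open>\<tau>\<close>, although the node no longer changes.\<close>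
  ultimately have "\<sigma> @ \<tau> = \<sigma>"
    using node_Suc[of \<rho> "list_encode \<tau>"] \<tau>(1) \<rho>(2) by (simp add: extend_def \<beta>_def)
  then show False using m \<tau>(3) by simp
qed

end

section \<open>The theorem\<close>

lemma totalize_eq_Some: "totalize h = Some q \<longleftrightarrow> (\<forall>n. h n = Some (q n))"
proof
  assume "totalize h = Some q"
  then show "\<forall>n. h n = Some (q n)" unfolding totalize_def by (auto split: if_splits)
qed (simp add: totalize_def)

lemma learn_reducible_valueE:
  assumes "\<And>e g. \<Phi> e g = totalize (\<lambda>n. run g u [e, n])"
    and "\<Phi> e g = \<Gamma> g" "g \<in> dom \<Gamma>" "the (\<Gamma> g) \<in> Q"
  shows "\<exists>q\<in>Q. \<forall>n. run g u [e, n] = Some (q n)"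
proof -
  obtain q where "\<Gamma> g = Some q" using assms(3) by blast
  then show ?thesis using assms by (auto simp: totalize_eq_Some)
qed

lemma pi01_singleton:
  assumes "computable f"
  shows "pi01 {f}"
proof -
  let ?R = "{\<sigma>. \<forall>i<length \<sigma>. \<sigma> ! i = f i}"
  have f: "effective f" using assms by (simp add: effective_computable)
  have "effective (\<lambda>\<sigma>. \<forall>i<length \<sigma>. hd (drop i \<sigma>) = f i)"
    by (intro effective_intros effective_comp[OF f])
  then have "effective (\<lambda>\<sigma>. \<sigma> \<in> ?R)" by (simp add: hd_drop_conv_nth)
  moreover have "{f} = {g. \<forall>n. prefix n g \<in> ?R}"
  proof (intro equalityI subsetI)
    fix g assume g: "g \<in> {g. \<forall>n. prefix n g \<in> ?R}"
    have "g i = f i" for i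
    proof -
      have "prefix (Suc i) g \<in> ?R" using g by blast
      then have "prefix (Suc i) g ! i = f i" unfolding mem_Collect_eq by (rule allE[of _ i]) simp
      then show ?thesis by (simp only: nth_prefix[OF lessI])
    qed
    then show "g \<in> {f}" by auto
  qed (auto simp: nth_prefix)
  ultimately show ?thesis unfolding pi01_def by (blast intro: computable_string_setI)
qed

theorem theorem51:
  fixes \<Phi> :: "nat \<Rightarrow> functional"
    and P Q :: "(nat \<Rightarrow> nat) set"
    and T\<^sub>P :: "nat list set"
  assumes "effective_enumeration \<Phi>"
    and "pi01 P" and "P \<subseteq> cantor" and "P \<noteq> {}"
    and "corresponding_tree T\<^sub>P P"
    and "pi01 Q" and "Q \<subseteq> cantor" and "special Q"
  shows "\<exists>P'. pi01 P' \<and> P' \<subseteq> nabla T\<^sub>P \<and> \<not> learn_reducible \<Phi> Q P'"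
proof -
  obtain u where u: "\<And>e g. \<Phi> e g = totalize (\<lambda>n. run g u [e, n])"
    and range_\<Phi>: "range \<Phi> = {F. partial_computable F}"
    using assms(1) unfolding effective_enumeration_def by blast
  have T: "binary_tree T\<^sub>P" "computable_string_set T\<^sub>P" "paths T\<^sub>P = P"
    using assms(5) unfolding corresponding_tree_def by blast+
  have Q: "\<And>f. f \<in> Q \<Longrightarrow> \<not> computable f" using assms(8) unfolding special_def by blast
  show ?thesis
  proof (cases "\<exists>f\<in>P. computable f")
    case True
    then obtain f where f: "f \<in> P" "computable f" by blast
    have "\<not> learn_reducible \<Phi> Q {f}"
    proof
      assume "learn_reducible \<Phi> Q {f}"
      then obtain \<Gamma> where "learnable_bounded \<Phi> \<Gamma>" "f \<in> dom \<Gamma>" "the (\<Gamma> f) \<in> Q"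
        unfolding learn_reducible_def by blast
      \<comment> \<open>At a single point the learner amounts to one fixed index.\<close>
      moreover from this obtain e where "\<Phi> e f = \<Gamma> f"
        unfolding learnable_bounded_def by blast
      ultimately obtain q where "q \<in> Q" "\<And>n. run f u [e, n] = Some (q n)"
        using learn_reducible_valueE[OF u] by blast
      then show False using computable_relative[OF f(2)] Q by blast
    qed
    moreover have "{f} \<subseteq> nabla T\<^sub>P" using f(1) T(3) paths_subset_nabla by blast
    ultimately show ?thesis using pi01_singleton[OF f(2)] by blast
  next
    case False
    obtain R where R: "computable_string_set R" and Q_eq: "Q = {f. \<forall>n. prefix n f \<in> R}"
      using assms(6) unfolding pi01_def by blast
    interpret diagonalization T\<^sub>P R u
    proof
      show "\<not> computable f" if "f \<in> paths T\<^sub>P" for f using that T(3) False by blast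
      show "\<not> computable f" if "\<And>n. prefix n f \<in> R" for f using that Q_eq Q by blast
      show "paths T\<^sub>P \<noteq> {}" using T(3) assms(4) by blast
    qed (rule T R)+
    have "\<not> learn_reducible \<Phi> Q diag"
    proof
      assume "learn_reducible \<Phi> Q diag"
      then obtain \<Gamma> where \<Gamma>: "learnable_bounded \<Phi> \<Gamma>" "diag \<subseteq> dom \<Gamma>" "\<forall>g\<in>diag. the (\<Gamma> g) \<in> Q"
        unfolding learn_reducible_def by blast
      from \<Gamma>(1) obtain \<Psi> b where \<Psi>: "computable_on_strings \<Psi>"
        and lim: "\<And>g. g \<in> dom \<Gamma> \<Longrightarrow> \<exists>e. (\<lambda>n. \<Psi> (prefix n g)) \<longlonglongrightarrow> e \<and> \<Phi> e g = \<Gamma> g"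
        and b: "\<And>g. g \<in> dom \<Gamma> \<Longrightarrow> finite (mind_changes \<Psi> g) \<and> card (mind_changes \<Psi> g) \<le> b"
        unfolding learnable_bounded_def by blast
      obtain p where p: "\<And>n. run (\<lambda>_. 0) p [n] = Some (\<Psi> (list_decode n))"
        using \<Psi> unfolding computable_on_strings_def computable_def by blast
      \<comment> \<open>The program of the learner defines a functional, which is listed with some
        index \<open>a\<close>. At the oracle 0 it is total, so \<open>u\<close> converges there to
        the values of the learner.\<close>
      have "(\<lambda>g. totalize (\<lambda>n. run g p [n])) \<in> range \<Phi>"
        unfolding range_\<Phi> partial_computable_def by blast
      then obtain a where "\<Phi> a = (\<lambda>g. totalize (\<lambda>n. run g p [n]))" by (metis imageE)
      then have "totalize (\<lambda>n. run (\<lambda>_. 0) u [a, n]) = totalize (\<lambda>n. run (\<lambda>_. 0) p [n])"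
        using u[of a "\<lambda>_. 0"] by simp
      also have "\<dots> = Some (\<lambda>n. \<Psi> (list_decode n))" by (simp add: totalize_eq_Some p)
      finally have a: "run (\<lambda>_. 0) u [a, list_encode \<sigma>] = Some (\<Psi> \<sigma>)" for \<sigma>
        by (simp add: totalize_eq_Some)
      show False
      proof (rule diag_not_learnable[OF a])
        fix g assume g: "g \<in> diag"
        then have dom: "g \<in> dom \<Gamma>" "the (\<Gamma> g) \<in> Q" using \<Gamma>(2,3) by blast+
        then obtain e where e: "(\<lambda>n. \<Psi> (prefix n g)) \<longlonglongrightarrow> e" "\<Phi> e g = \<Gamma> g"
          using lim by blast
        obtain q where "q \<in> Q" "\<forall>n. run g u [e, n] = Some (q n)"
          using learn_reducible_valueE[where \<Phi> = \<Phi>, OF u e(2) dom] by blast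
        with e(1) show "\<exists>e q. (\<lambda>n. \<Psi> (prefix n g)) \<longlonglongrightarrow> e \<and>
            (\<forall>i. run g u [e, i] = Some (q i)) \<and> (\<forall>n. prefix n q \<in> R)"
          using Q_eq by blast
        show "finite (mind_changes \<Psi> g) \<and> card (mind_changes \<Psi> g) \<le> b"
          using b \<Gamma>(2) g by blast
      qed
    qed
    then show ?thesis using pi01_diag diag_subset_nabla by blast
  qed
qed

end
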